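(* Let $H$ be a graph and $n\geq 2$ an integer. Then: (1) If $H$ is vertex-transitive and $F$ is an $H$-forest, then $\chi_F(\mathbb{R}^n)=\chi_H(\mathbb{R}^n)$ and $\chi^{\mathrm{ind}}_F(\mathbb{R}^n)=\chi^{\mathrm{ind}}_H(\mathbb{R}^n)$. (2) If $H$ has zero hypercube Turán density, then $\chi_H(\mathbb{R}^n)=\chi(\mathbb{R}^n)$; if $H$ has zero induced hypercube Turán density, then $\chi^{\mathrm{ind}}_H(\mathbb{R}^n)=\chi(\mathbb{R}^n)$. (3) Let $u,v$ be two vertices of $H$, let $\Gamma$ be a bipartite graph with parts $A$ and $B$ which has zero strong hypercube Turán density with respect to $(A,B)$, and let $F=\Gamma_{A,B}(H,u,v)$. Then $\chi_F(\mathbb{R}^n)=\chi_H(\mathbb{R}^n)$.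
   Context: Graphs are finite and non-empty. A unit-copy of $H=(V,E)$ in $\mathbb{R}^n$ is a set $A\subseteq\mathbb{R}^n$, $|A|=|V|$, with a bijection $f:V\to A$ such that $uv\in E$ implies $\|f(u)-f(v)\|=1$; it is induced if also $uv\notin E$ implies $\|f(u)-f(v)\|\neq1$. $\chi_H(\mathbb{R}^n)$ (resp. $\chi^{\mathrm{ind}}_H(\mathbb{R}^n)$) is the least $r$ such that some $r$-coloring of $\mathbb{R}^n$ has no monochromatic unit-copy (resp. induced unit-copy) of $H$; $\chi(\mathbb{R}^n)$ is the chromatic number of $\mathbb{R}^n$ (least number of colors with no two same-colored points at distance $1$). An $H$-forest is a union of pairwise edge-disjoint copies $H_1,\dots,H_m$ of $H$ with each $V(H_i)$ meeting $\bigcup_{j<i}V(H_j)$ in at most one vertex. The hypercube $Q_N$ has vertex set $\{0,1\}^N$, adjacency = differing in exactly one coordinate; its $k$-th vertex layer consists of vertices with exactly $k$ ones. $H$ has zero (induced) hypercube Turán density if the maximum fraction of edges of $Q_N$ in a subgraph of $Q_N$ with no (induced) copy of $H$ tends to $0$ as $N\to\infty$. For a bipartite $\Gamma$ with parts $A,B$, $m(N,\Gamma,A,B)$ is the maximum number of edges of a subgraph of $Q_N$ with no copy of $\Gamma$ having its $A$-vertices in the $k$-th vertex layer and its $B$-vertices in the $(k-1)$-th vertex layer for some $k\le N$; zero strong hypercube Turán density w.r.t. $(A,B)$ means $m(N,\Gamma,A,B)=o(|E(Q_N)|)$. $\Gamma_{A,B}(H,u,v)$ is obtained from $\Gamma$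 by replacing each edge $ab$ ($a\in A,b\in B$) with a copy of $H$ in which $(a,b)$ plays the role of $(u,v)$. *)

theory Defs
  imports "HOL-Analysis.Analysis" "HOL-Library.Landau_Symbols" "HOL-Library.Extended_Nat"
begin

type_synonym 'v graph = "'v set \<times> 'v set set"

abbreviation verts :: "'v graph \<Rightarrow> 'v set" where "verts \<equiv> fst"
abbreviation edges :: "'v graph \<Rightarrow> 'v set set" where "edges \<equiv> snd"

definition simple_graph :: "'v graph \<Rightarrow> bool" where
  "simple_graph G \<longleftrightarrow> finite (verts G) \<and> verts G \<noteq> {} \<and>
     edges G \<subseteq> {{x, y} | x y. x \<in> verts G \<and> y \<in> verts G \<and> x \<noteq> y}"

definition subgraph :: "'v graph \<Rightarrow> 'v graph \<Rightarrow> bool" where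
  "subgraph K G \<longleftrightarrow> verts K \<subseteq> verts G \<and> edges K \<subseteq> edges G \<and> edges K \<subseteq> Pow (verts K)"

definition induced_subgraph :: "'v graph \<Rightarrow> 'v graph \<Rightarrow> bool" where
  "induced_subgraph K G \<longleftrightarrow> verts K \<subseteq> verts G \<and> edges K = {e \<in> edges G. e \<subseteq> verts K}"

definition graph_iso :: "('v \<Rightarrow> 'w) \<Rightarrow> 'v graph \<Rightarrow> 'w graph \<Rightarrow> bool" where
  "graph_iso f G K \<longleftrightarrow> bij_betw f (verts G) (verts K) \<and> edges K = (\<lambda>e. f ` e) ` edges G"

definition copy_of :: "'w graph \<Rightarrow> 'v graph \<Rightarrow> bool" where
  "copy_of K H \<longleftrightarrow> (\<exists>f. graph_iso f H K)"

definition contains_copy :: "'w graph \<Rightarrow> 'v graph \<Rightarrow> bool" where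
  "contains_copy G H \<longleftrightarrow> (\<exists>K. subgraph K G \<and> copy_of K H)"

definition contains_induced_copy :: "'w graph \<Rightarrow> 'v graph \<Rightarrow> bool" where
  "contains_induced_copy G H \<longleftrightarrow> (\<exists>K. induced_subgraph K G \<and> copy_of K H)"

definition vertex_transitive :: "'v graph \<Rightarrow> bool" where
  "vertex_transitive H \<longleftrightarrow>
     (\<forall>x \<in> verts H. \<forall>y \<in> verts H. \<exists>f. graph_iso f H H \<and> f x = y)"

definition is_forest_of :: "'w graph \<Rightarrow> 'v graph \<Rightarrow> bool" where
  "is_forest_of F H \<longleftrightarrow> (\<exists>Hs :: 'w graph list.
     Hs \<noteq> [] \<and>
     (\<forall>i < length Hs. copy_of (Hs ! i) H) \<and>
     (\<forall>i < length Hs. \<forall>j < i. edges (Hs ! i) \<inter> edges (Hs ! j) = {}) \<and>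
     (\<forall>i < length Hs. card (verts (Hs ! i) \<inter> (\<Union>j<i. verts (Hs ! j))) \<le> 1) \<and>
     F = (\<Union>i<length Hs. verts (Hs ! i), \<Union>i<length Hs. edges (Hs ! i)))"

definition bipartite_with_parts :: "'v graph \<Rightarrow> 'v set \<Rightarrow> 'v set \<Rightarrow> bool" where
  "bipartite_with_parts G A B \<longleftrightarrow> A \<union> B = verts G \<and> A \<inter> B = {} \<and>
     (\<forall>e \<in> edges G. \<exists>a \<in> A. \<exists>b \<in> B. e = {a, b})"

definition unit_copy :: "'v graph \<Rightarrow> 'a::real_normed_vector set \<Rightarrow> bool" where
  "unit_copy H A \<longleftrightarrow> (\<exists>f. bij_betw f (verts H) A \<and>
     (\<forall>x \<in> verts H. \<forall>y \<in> verts H. {x, y} \<in> edges H \<longrightarrow> norm (f x - f y) = 1))"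

definition induced_unit_copy :: "'v graph \<Rightarrow> 'a::real_normed_vector set \<Rightarrow> bool" where
  "induced_unit_copy H A \<longleftrightarrow> (\<exists>f. bij_betw f (verts H) A \<and>
     (\<forall>x \<in> verts H. \<forall>y \<in> verts H. {x, y} \<in> edges H \<longrightarrow> norm (f x - f y) = 1) \<and>
     (\<forall>x \<in> verts H. \<forall>y \<in> verts H. {x, y} \<notin> edges H \<longrightarrow> norm (f x - f y) \<noteq> 1))"

definition monochromatic :: "('a \<Rightarrow> nat) \<Rightarrow> 'a set \<Rightarrow> bool" where
  "monochromatic c A \<longleftrightarrow> (\<exists>i. \<forall>x \<in> A. c x = i)"

text \<open>In the following three definitions, the value is \<open>\<infinity>\<close> (the infimum of the empty
  set) if no finite number of colours suffices.\<close>

definition chi_copy :: "'v graph \<Rightarrow> 'a::real_normed_vector set \<Rightarrow> enat" where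
  "chi_copy H X = (INF r \<in> {r. \<exists>c. c \<in> X \<rightarrow> {..<r} \<and>
     \<not> (\<exists>A \<subseteq> X. unit_copy H A \<and> monochromatic c A)}. enat r)"

definition chi_ind_copy :: "'v graph \<Rightarrow> 'a::real_normed_vector set \<Rightarrow> enat" where
  "chi_ind_copy H X = (INF r \<in> {r. \<exists>c. c \<in> X \<rightarrow> {..<r} \<and>
     \<not> (\<exists>A \<subseteq> X. induced_unit_copy H A \<and> monochromatic c A)}. enat r)"

definition chi :: "'a::real_normed_vector set \<Rightarrow> enat" where
  "chi X = (INF r \<in> {r. \<exists>c. c \<in> X \<rightarrow> {..<r} \<and>
     (\<forall>x \<in> X. \<forall>y \<in> X. norm (x - y) = 1 \<longrightarrow> c x \<noteq> c y)}. enat r)"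

definition cube_verts :: "nat \<Rightarrow> (nat \<Rightarrow> nat) set" where
  "cube_verts N = {..<N} \<rightarrow>\<^sub>E {0, 1}"

definition hypercube :: "nat \<Rightarrow> (nat \<Rightarrow> nat) graph" where
  "hypercube N = (cube_verts N,
     {{x, y} | x y. x \<in> cube_verts N \<and> y \<in> cube_verts N \<and> card {i. i < N \<and> x i \<noteq> y i} = 1})"

definition layer :: "nat \<Rightarrow> nat \<Rightarrow> (nat \<Rightarrow> nat) set" where
  "layer N k = {x \<in> cube_verts N. card {i. i < N \<and> x i = 1} = k}"

definition cube_ex :: "nat \<Rightarrow> 'v graph \<Rightarrow> nat" where
  "cube_ex N H = Max {card (edges G) | G. subgraph G (hypercube N) \<and> \<not> contains_copy G H}"

definition cube_ex_ind :: "nat \<Rightarrow> 'v graph \<Rightarrow> nat" where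
  "cube_ex_ind N H =
     Max {card (edges G) | G. subgraph G (hypercube N) \<and> \<not> contains_induced_copy G H}"

definition zero_cube_density :: "'v graph \<Rightarrow> bool" where
  "zero_cube_density H \<longleftrightarrow>
     (\<lambda>N. real (cube_ex N H) / real (card (edges (hypercube N)))) \<longlonglongrightarrow> 0"

definition zero_induced_cube_density :: "'v graph \<Rightarrow> bool" where
  "zero_induced_cube_density H \<longleftrightarrow>
     (\<lambda>N. real (cube_ex_ind N H) / real (card (edges (hypercube N)))) \<longlonglongrightarrow> 0"

definition contains_layered_copy ::
  "nat \<Rightarrow> (nat \<Rightarrow> nat) graph \<Rightarrow> 'v graph \<Rightarrow> 'v set \<Rightarrow> 'v set \<Rightarrow> bool" where
  "contains_layered_copy N G \<Gamma> A B \<longleftrightarrow> (\<exists>K f k. subgraph K G \<and> graph_iso f \<Gamma> K \<and>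
     1 \<le> k \<and> k \<le> N \<and> f ` A \<subseteq> layer N k \<and> f ` B \<subseteq> layer N (k - 1))"

definition cube_ex_strong :: "nat \<Rightarrow> 'v graph \<Rightarrow> 'v set \<Rightarrow> 'v set \<Rightarrow> nat" where
  "cube_ex_strong N \<Gamma> A B =
     Max {card (edges G) | G. subgraph G (hypercube N) \<and> \<not> contains_layered_copy N G \<Gamma> A B}"

definition zero_strong_cube_density :: "'v graph \<Rightarrow> 'v set \<Rightarrow> 'v set \<Rightarrow> bool" where
  "zero_strong_cube_density \<Gamma> A B \<longleftrightarrow>
     (\<lambda>N. real (cube_ex_strong N \<Gamma> A B)) \<in> o(\<lambda>N. real (card (edges (hypercube N))))"

text \<open>The vertices of \<open>\<Gamma>\<close> are tagged \<open>Inl\<close>. The copy of \<open>H\<close> replacing the edge \<open>ab\<close> is the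
  image of \<open>H\<close> under \<open>role u v a b\<close>; each vertex \<open>w\<close> of it other than \<open>u, v\<close> becomes
  the new vertex \<open>Inr ((a, b), w)\<close>, private to that copy.\<close>

definition role :: "'v \<Rightarrow> 'v \<Rightarrow> 'g \<Rightarrow> 'g \<Rightarrow> 'v \<Rightarrow> 'g + ('g \<times> 'g) \<times> 'v" where
  "role u v a b w = (if w = u then Inl a else if w = v then Inl b else Inr ((a, b), w))"

definition edge_replacement ::
  "'g graph \<Rightarrow> 'g set \<Rightarrow> 'g set \<Rightarrow> 'v graph \<Rightarrow> 'v \<Rightarrow> 'v \<Rightarrow> ('g + ('g \<times> 'g) \<times> 'v) graph" where
  "edge_replacement \<Gamma> A B H u v =
     (let P = {(a, b). a \<in> A \<and> b \<in> B \<and> {a, b} \<in> edges \<Gamma>} in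
       (Inl ` verts \<Gamma> \<union> (\<Union>(a, b) \<in> P. role u v a b ` verts H),
        \<Union>(a, b) \<in> P. (\<lambda>e. role u v a b ` e) ` edges H))"

end

theory Submission imports Defs begin

text \<open>
  By compactness, if every \<open>r\<close>-colouring of the space contains a monochromatic copy of \<open>H\<close>, then so
  does every \<open>r\<close>-colouring of some finite set \<open>X\<close>. For generic orthogonal maps \<open>\<rho>\<^sub>1, \<dots>, \<rho>\<^sub>N\<close> the
  map \<open>x \<mapsto> \<rho>\<^sub>1 x\<^sub>1 + \<dots> + \<rho>\<^sub>N x\<^sub>N\<close> embeds the grid \<open>X\<^sup>N\<close> into the space so that every axis-parallel
  line is an isometric copy of \<open>X\<close> and two points on no common line are never at distance 1. Hence in
  any \<open>r\<close>-colouring of the space every line of the grid contains a monochromatic copy of \<open>H\<close>.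

  For hypercube densities, a random subcube of the grid has a positive proportion, independent of
  \<open>N\<close>, of edges whose end points play prescribed roles in such copies of one fixed colour, so the
  density assumption applies; the chromatic number is the case where \<open>H\<close> is a single edge. For
  forests, the copies of one colour form a hypergraph whose average degree grows with \<open>N\<close>; it
  contains a subhypergraph of large minimum degree, into which a forest is embedded greedily.
\<close>

section \<open>Unit embeddings and the partition relation\<close>

definition graph_embedding :: "bool \<Rightarrow> ('v \<Rightarrow> 'w) \<Rightarrow> 'v graph \<Rightarrow> 'w graph \<Rightarrow> bool" where
  "graph_embedding ind f H G \<longleftrightarrow> inj_on f (verts H) \<and> f ` verts H \<subseteq> verts G \<and>
     (\<forall>x\<in>verts H. \<forall>y\<in>verts H. {x, y} \<in> edges H \<longrightarrow> {f x, f y} \<in> edges G) \<and>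
     (ind \<longrightarrow> (\<forall>x\<in>verts H. \<forall>y\<in>verts H. {f x, f y} \<in> edges G \<longrightarrow> {x, y} \<in> edges H))"

definition unit_embedding :: "bool \<Rightarrow> 'v graph \<Rightarrow> ('v \<Rightarrow> 'a::real_normed_vector) \<Rightarrow> bool" where
  "unit_embedding ind H g \<longleftrightarrow> inj_on g (verts H) \<and>
     (\<forall>x\<in>verts H. \<forall>y\<in>verts H. {x, y} \<in> edges H \<longrightarrow> norm (g x - g y) = 1) \<and>
     (ind \<longrightarrow> (\<forall>x\<in>verts H. \<forall>y\<in>verts H. {x, y} \<notin> edges H \<longrightarrow> norm (g x - g y) \<noteq> 1))"

text \<open>In the partition calculus this is written \<open>X \<longrightarrow> (H)\<^sub>r\<close>.\<close>

definition arrows :: "bool \<Rightarrow> 'a::real_normed_vector set \<Rightarrow> 'v graph \<Rightarrow> nat \<Rightarrow> bool" where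
  "arrows ind X H r \<longleftrightarrow> (\<forall>c \<in> X \<rightarrow> {..<r}.
     \<exists>g. unit_embedding ind H g \<and> g ` verts H \<subseteq> X \<and> monochromatic c (g ` verts H))"

definition single_edge :: "bool graph" where
  "single_edge = ({False, True}, {{False, True}})"

lemma verts_single_edge [simp]: "verts single_edge = {False, True}"
  by (simp add: single_edge_def)

lemma simple_graph_edge_subset: "simple_graph H \<Longrightarrow> e \<in> edges H \<Longrightarrow> e \<subseteq> verts H"
  unfolding simple_graph_def by blast

lemma simple_graph_edgeE:
  assumes "simple_graph H" "e \<in> edges H"
  obtains x y where "e = {x, y}" "x \<in> verts H" "y \<in> verts H" "x \<noteq> y"
  using assms unfolding simple_graph_def by blast

lemma
  assumes "graph_embedding ind f H G"
  shows graph_embedding_inj_on: "inj_on f (verts H)"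
    and graph_embedding_image: "f ` verts H \<subseteq> verts G"
  using assms unfolding graph_embedding_def by blast+

lemma
  assumes "unit_embedding ind H g"
  shows unit_embedding_inj_on: "inj_on g (verts H)"
    and unit_embedding_edge:
      "\<lbrakk>x \<in> verts H; y \<in> verts H; {x, y} \<in> edges H\<rbrakk> \<Longrightarrow> norm (g x - g y) = 1"
    and unit_embedding_induced:
      "\<lbrakk>ind; x \<in> verts H; y \<in> verts H; norm (g x - g y) = 1\<rbrakk> \<Longrightarrow> {x, y} \<in> edges H"
  using assms unfolding unit_embedding_def by blast+

lemma graph_embedding_comp:
  assumes emb_f: "graph_embedding ind f H K" and emb_g: "graph_embedding ind g K G"
  shows "graph_embedding ind (g \<circ> f) H G"
proof -
  have "inj_on (g \<circ> f) (verts H)"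
    using comp_inj_on inj_on_subset graph_embedding_inj_on[OF emb_f]
      graph_embedding_inj_on[OF emb_g] graph_embedding_image[OF emb_f] by metis
  then show ?thesis
    using emb_f emb_g unfolding graph_embedding_def image_subset_iff comp_apply by blast
qed

lemma graph_iso_imp_embedding:
  assumes iso: "graph_iso f H K" and simple: "simple_graph H"
  shows "graph_embedding ind f H K"
proof -
  have inj: "inj_on f (verts H)" and verts: "f ` verts H = verts K"
    and edges: "edges K = (\<lambda>e. f ` e) ` edges H"
    using iso by (auto simp: graph_iso_def bij_betw_def)
  have "{f x, f y} \<in> edges K \<longleftrightarrow> {x, y} \<in> edges H"
    if xy: "x \<in> verts H" "y \<in> verts H" for x y
  proof
    show "{f x, f y} \<in> edges K" if "{x, y} \<in> edges H"
      using imageI[OF that, of "\<lambda>e. f ` e"] unfolding edges by simp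
    assume "{f x, f y} \<in> edges K"
    then obtain e where e: "e \<in> edges H" "f ` e = f ` {x, y}" unfolding edges by auto
    then have "e = {x, y}"
      using inj_on_image_eq_iff[OF inj simple_graph_edge_subset[OF simple e(1)], of "{x, y}"]
        xy by blast
    then show "{x, y} \<in> edges H" using e(1) by simp
  qed
  then show ?thesis using inj verts by (simp add: graph_embedding_def)
qed

lemma graph_iso_inv_into:
  assumes iso: "graph_iso f H K" and simple: "simple_graph H"
  shows "graph_iso (inv_into (verts H) f) K H"
proof -
  have bij: "bij_betw f (verts H) (verts K)" and edges: "edges K = (\<lambda>e. f ` e) ` edges H"
    using iso by (auto simp: graph_iso_def)
  have "inv_into (verts H) f ` (f ` e) = e" if "e \<in> edges H" for e
    using bij simple_graph_edge_subset[OF simple that]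
    by (simp add: bij_betw_def inv_into_image_cancel)
  then have "(\<lambda>e. inv_into (verts H) f ` e) ` edges K = edges H"
    unfolding edges image_image by simp
  then show ?thesis using bij_betw_inv_into[OF bij] by (simp add: graph_iso_def)
qed

lemma simple_graph_iso:
  assumes iso: "graph_iso f H K" and simple: "simple_graph H"
  shows "simple_graph K"
proof -
  have inj: "inj_on f (verts H)" and verts: "verts K = f ` verts H"
    and edges: "edges K = (\<lambda>e. f ` e) ` edges H"
    using iso by (auto simp: graph_iso_def bij_betw_def)
  have "\<exists>x y. e = {x, y} \<and> x \<in> verts K \<and> y \<in> verts K \<and> x \<noteq> y" if e_edge: "e \<in> edges K" for e
  proof -
    obtain e' where "e' \<in> edges H" and e_image: "e = f ` e'" using e_edge unfolding edges by auto
    then obtain x y where xy: "e' = {x, y}" "x \<in> verts H" "y \<in> verts H" "x \<noteq> y"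
      using simple_graph_edgeE[OF simple] by blast
    then have "f x \<noteq> f y" using inj by (auto simp: inj_on_def)
    then show ?thesis using xy e_image verts by auto
  qed
  then show ?thesis using simple verts unfolding simple_graph_def by auto
qed

lemma copy_imp_embedding:
  assumes "copy_of K H" and simple: "simple_graph H" and incl: "graph_embedding ind id K G"
  shows "\<exists>f. graph_embedding ind f H G"
proof -
  obtain f where "graph_iso f H K" using assms(1) unfolding copy_of_def by blast
  from graph_embedding_comp[OF graph_iso_imp_embedding[OF this simple] incl] show ?thesis by blast
qed

lemma contains_copy_imp_embedding:
  assumes "contains_copy G H" and simple: "simple_graph H"
  shows "\<exists>f. graph_embedding False f H G"
proof -
  obtain K where "subgraph K G" "copy_of K H" using assms(1) unfolding contains_copy_def by blast
  moreover from this have "graph_embedding False id K G"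
    by (auto simp: subgraph_def graph_embedding_def)
  ultimately show ?thesis using copy_imp_embedding[OF _ simple] by blast
qed

lemma contains_induced_copy_imp_embedding:
  assumes "contains_induced_copy G H" and simple: "simple_graph H"
  shows "\<exists>f. graph_embedding ind f H G"
proof -
  obtain K where "induced_subgraph K G" "copy_of K H"
    using assms(1) unfolding contains_induced_copy_def by blast
  moreover from this have "graph_embedding ind id K G"
    by (auto simp: induced_subgraph_def graph_embedding_def)
  ultimately show ?thesis using copy_imp_embedding[OF _ simple] by blast
qed

lemma single_edge_embedding:
  assumes simple: "simple_graph H" and "edges H \<noteq> {}"
  shows "\<exists>f. graph_embedding False f single_edge H"
proof -
  obtain e where "e \<in> edges H" using assms(2) by blast
  then obtain x y where xy: "{x, y} \<in> edges H" "x \<in> verts H" "y \<in> verts H" "x \<noteq> y"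
    using simple_graph_edgeE[OF simple] by metis
  then have "{y, x} \<in> edges H" by (simp add: insert_commute)
  with xy have "graph_embedding False (\<lambda>b. if b then x else y) single_edge H"
    by (simp add: graph_embedding_def single_edge_def doubleton_eq_iff)
  then show ?thesis by blast
qed

lemma unit_embedding_comp:
  assumes emb: "graph_embedding ind f H G" and unit: "unit_embedding ind G g"
  shows "unit_embedding ind H (g \<circ> f)"
proof -
  have "inj_on (g \<circ> f) (verts H)"
    using comp_inj_on inj_on_subset graph_embedding_inj_on[OF emb] unit_embedding_inj_on[OF unit]
      graph_embedding_image[OF emb] by metis
  then show ?thesis
    using emb unit unfolding graph_embedding_def unit_embedding_def image_subset_iff comp_apply
    by blast
qed

lemma unit_embedding_single_edge: "unit_embedding False single_edge g \<longleftrightarrow> norm (g True - g False) = 1"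
  using norm_minus_commute[of "g True" "g False"]
  by (auto simp: unit_embedding_def single_edge_def doubleton_eq_iff)

lemma unit_copy_iff: "unit_copy H A \<longleftrightarrow> (\<exists>g. unit_embedding False H g \<and> A = g ` verts H)"
  unfolding unit_copy_def unit_embedding_def bij_betw_def by auto

lemma induced_unit_copy_iff:
  "induced_unit_copy H A \<longleftrightarrow> (\<exists>g. unit_embedding True H g \<and> A = g ` verts H)"
  unfolding induced_unit_copy_def unit_embedding_def bij_betw_def by auto

lemma chi_copy_eq: "chi_copy H X = (INF r \<in> {r. \<not> arrows False X H r}. enat r)"
proof -
  have "(\<exists>A\<subseteq>X. unit_copy H A \<and> monochromatic c A) \<longleftrightarrow>
      (\<exists>g. unit_embedding False H g \<and> g ` verts H \<subseteq> X \<and> monochromatic c (g ` verts H))" for c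
    unfolding unit_copy_iff by auto
  then show ?thesis by (simp add: chi_copy_def arrows_def Bex_def)
qed

lemma chi_ind_copy_eq: "chi_ind_copy H X = (INF r \<in> {r. \<not> arrows True X H r}. enat r)"
proof -
  have "(\<exists>A\<subseteq>X. induced_unit_copy H A \<and> monochromatic c A) \<longleftrightarrow>
      (\<exists>g. unit_embedding True H g \<and> g ` verts H \<subseteq> X \<and> monochromatic c (g ` verts H))" for c
    unfolding induced_unit_copy_iff by auto
  then show ?thesis by (simp add: chi_ind_copy_def arrows_def Bex_def)
qed

lemma arrows_single_edge_iff:
  "arrows False X single_edge r \<longleftrightarrow>
     (\<forall>c \<in> X \<rightarrow> {..<r}. \<exists>x\<in>X. \<exists>y\<in>X. norm (x - y) = 1 \<and> c x = c y)"
proof -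
  have "(\<exists>g. unit_embedding False single_edge g \<and> g ` verts single_edge \<subseteq> X \<and>
        monochromatic c (g ` verts single_edge)) \<longleftrightarrow>
      (\<exists>x\<in>X. \<exists>y\<in>X. norm (x - y) = 1 \<and> c x = c y)" (is "?L \<longleftrightarrow> ?R") for c
  proof
    assume ?L
    then show ?R by (auto simp: unit_embedding_single_edge monochromatic_def)
  next
    assume ?R
    then obtain x y where "x \<in> X" "y \<in> X" "norm (x - y) = 1" "c x = c y" by blast
    then show ?L
      by (intro exI[of _ "\<lambda>b. if b then x else y"])
        (auto simp: unit_embedding_single_edge monochromatic_def)
  qed
  then show ?thesis unfolding arrows_def by simp
qed

lemma chi_eq: "chi X = (INF r \<in> {r. \<not> arrows False X single_edge r}. enat r)"
  unfolding chi_def arrows_single_edge_iff by (rule arg_cong[where f = Inf]) auto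

lemma arrows_if_embedding:
  assumes emb: "graph_embedding ind f H F" and arrows: "arrows ind X F r"
  shows "arrows ind X H r"
  unfolding arrows_def
proof
  fix c assume "c \<in> X \<rightarrow> {..<r}"
  then obtain g where g: "unit_embedding ind F g" "g ` verts F \<subseteq> X" "monochromatic c (g ` verts F)"
    using arrows unfolding arrows_def by blast
  have "(g \<circ> f) ` verts H \<subseteq> g ` verts F" using graph_embedding_image[OF emb] by auto
  then show "\<exists>g. unit_embedding ind H g \<and> g ` verts H \<subseteq> X \<and> monochromatic c (g ` verts H)"
    using unit_embedding_comp[OF emb g(1)] g(2,3) unfolding monochromatic_def by blast
qed

lemma arrows_weaken_induced: "arrows ind X H r \<Longrightarrow> arrows False X H r"
  unfolding arrows_def unit_embedding_def by blast

lemma openin_monochromatic: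
  assumes "finite A"
  shows "openin (product_topology (\<lambda>_. discrete_topology C) UNIV) {c \<in> UNIV \<rightarrow> C. monochromatic c A}"
proof -
  define box where "box i = Pi\<^sub>E UNIV (\<lambda>x. if x \<in> A then C \<inter> {i} else C)" for i
  have "finite {x. (if x \<in> A then C \<inter> {i} else C) \<noteq> C}" for i
    by (rule finite_subset[OF _ assms]) auto
  then have "openin (product_topology (\<lambda>_. discrete_topology C) UNIV) (box i)" for i
    unfolding box_def by (subst openin_PiE_gen) auto
  then have "openin (product_topology (\<lambda>_. discrete_topology C) UNIV) (\<Union>i. box i)" by blast
  moreover have "{c \<in> UNIV \<rightarrow> C. monochromatic c A} = (\<Union>i. box i)"
    by (fastforce simp: box_def monochromatic_def PiE_iff Pi_iff split: if_splits)
  ultimately show ?thesis by simp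
qed

lemma colouring_compactness:
  fixes \<A> :: "'a set set"
  assumes "finite C" and fin: "\<And>A. A \<in> \<A> \<Longrightarrow> finite A"
    and mono: "\<And>c. c \<in> UNIV \<rightarrow> C \<Longrightarrow> \<exists>A\<in>\<A>. monochromatic c A"
  shows "\<exists>X. finite X \<and> (\<forall>c \<in> X \<rightarrow> C. \<exists>A\<in>\<A>. A \<subseteq> X \<and> monochromatic c A)"
proof -
  define T where "T = product_topology (\<lambda>_::'a. discrete_topology C) UNIV"
  define U where "U A = {c \<in> UNIV \<rightarrow> C. monochromatic c A}" for A :: "'a set"
  have top: "topspace T = UNIV \<rightarrow> C" by (auto simp: T_def PiE_iff)
  have "compact_space T"
    using \<open>finite C\<close>
    by (simp add: T_def compact_space_product_topology compact_space_discrete_topology)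
  moreover have "\<forall>V \<in> U ` \<A>. openin T V"
    unfolding T_def U_def using openin_monochromatic[OF fin] by blast
  moreover have "topspace T \<subseteq> \<Union>(U ` \<A>)" using mono by (auto simp: top U_def)
  ultimately obtain \<F> where "finite \<F>" "\<F> \<subseteq> U ` \<A>" and cover: "topspace T \<subseteq> \<Union>\<F>"
    unfolding compact_space_alt by meson
  then obtain \<B> where \<B>: "finite \<B>" "\<B> \<subseteq> \<A>" "\<F> = U ` \<B>" by (meson finite_subset_image)
  define X where "X = insert undefined (\<Union>\<B>)"
  have "finite X" using \<B> fin by (auto simp: X_def)
  moreover have "\<exists>A\<in>\<A>. A \<subseteq> X \<and> monochromatic c A" if colouring: "c \<in> X \<rightarrow> C" for c
  proof -
    define c' where "c' x = (if x \<in> X then c x else c undefined)" for x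
    have "c' \<in> topspace T" using colouring by (auto simp: top c'_def X_def)
    then obtain A where A: "A \<in> \<B>" "monochromatic c' A" using cover \<B>(3) by (auto simp: U_def)
    then have "A \<subseteq> X" by (auto simp: X_def)
    moreover have "monochromatic c A"
      using A(2) \<open>A \<subseteq> X\<close> unfolding monochromatic_def c'_def by (metis subsetD)
    ultimately show ?thesis using A \<B>(2) by blast
  qed
  ultimately show ?thesis by blast
qed

lemma arrows_finite_subset:
  fixes H :: "'v graph"
  assumes "finite (verts H)" and arrows: "arrows ind (UNIV :: 'a::real_normed_vector set) H r"
  shows "\<exists>X :: 'a set. finite X \<and> arrows ind X H r"
proof -
  define \<A> where "\<A> = {g ` verts H | g :: 'v \<Rightarrow> 'a. unit_embedding ind H g}"
  have "\<exists>A\<in>\<A>. monochromatic c A" if colouring: "c \<in> UNIV \<rightarrow> {..<r}" for c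
    using bspec[OF arrows[unfolded arrows_def] colouring] by (auto simp: \<A>_def)
  moreover have "finite A" if "A \<in> \<A>" for A using that assms(1) by (auto simp: \<A>_def)
  ultimately obtain X where "finite X"
    and unavoidable: "\<forall>c \<in> X \<rightarrow> {..<r}. \<exists>A\<in>\<A>. A \<subseteq> X \<and> monochromatic c A"
    using colouring_compactness[OF finite_lessThan] by metis
  have "arrows ind X H r"
    unfolding arrows_def
  proof
    fix c assume "c \<in> X \<rightarrow> {..<r}"
    then obtain A where "A \<in> \<A>" "A \<subseteq> X" "monochromatic c A" using unavoidable by blast
    then show "\<exists>g. unit_embedding ind H g \<and> g ` verts H \<subseteq> X \<and> monochromatic c (g ` verts H)"
      unfolding \<A>_def by blast
  qed
  then show ?thesis using \<open>finite X\<close> by blast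
qed

section \<open>Generic maps of grids\<close>

lemma finite_roots_real_polynomial_function:
  fixes p :: "real \<Rightarrow> real"
  assumes "real_polynomial_function p" and "p t0 \<noteq> 0"
  shows "finite {t. p t = 0}"
proof -
  obtain a n where p: "p = (\<lambda>t. \<Sum>i\<le>n. a i * t ^ i)"
    using assms(1) unfolding real_polynomial_function_iff_sum by blast
  have "\<exists>i\<le>n. a i \<noteq> 0"
  proof (rule ccontr)
    assume "\<not> ?thesis"
    then have "p t0 = 0" by (simp add: p)
    with assms(2) show False by contradiction
  qed
  then show ?thesis unfolding p by (simp add: polyfun_finite_roots)
qed

lemma exists_common_nonroot:
  fixes Q :: "('a::real_normed_vector \<Rightarrow> real) set"
  assumes "finite Q" and "\<forall>q\<in>Q. real_polynomial_function q \<and> (\<exists>a. q a \<noteq> 0)"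
  shows "\<exists>a. \<forall>q\<in>Q. q a \<noteq> 0"
  using assms
proof (induction Q)
  case empty
  then show ?case by simp
next
  case (insert q Q)
  obtain a where a: "\<forall>p\<in>Q. p a \<noteq> 0" using insert by auto
  obtain b where b: "q b \<noteq> 0" using insert.prems by auto
  define line where "line t = a + t *\<^sub>R (b - a)" for t
  have "polynomial_function line"
    unfolding line_def by (intro polynomial_function_add polynomial_function_mult) auto
  then have poly: "real_polynomial_function (p \<circ> line)" if "p \<in> insert q Q" for p
    using insert.prems that by (intro real_polynomial_function_compose) auto
  have "(p \<circ> line) (if p = q then 1 else 0) \<noteq> 0" if "p \<in> insert q Q" for p
    using a b that by (auto simp: line_def)
  then have "finite {t. (p \<circ> line) t = 0}" if "p \<in> insert q Q" for p
    using finite_roots_real_polynomial_function[OF poly] that by blast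
  then have "finite (\<Union>p\<in>insert q Q. {t. (p \<circ> line) t = 0})" using insert.hyps(1) by blast
  then obtain t where "t \<notin> (\<Union>p\<in>insert q Q. {t. (p \<circ> line) t = 0})"
    using ex_new_if_finite[OF infinite_UNIV_char_0] by blast
  then show ?case by (intro exI[of _ "line t"]) auto
qed

definition reflection :: "'a::euclidean_space \<Rightarrow> 'a \<Rightarrow> 'a" where
  "reflection a x = x - (2 * (a \<bullet> x) / (a \<bullet> a)) *\<^sub>R a"

lemma orthogonal_transformation_reflection: "orthogonal_transformation (reflection a)"
proof -
  have "linear (reflection a)"
    by (rule linearI)
      (simp_all add: reflection_def algebra_simps inner_simps add_divide_distrib scaleR_add_left)
  moreover have "reflection a v \<bullet> reflection a w = v \<bullet> w" for v w
    by (cases "a = 0") (simp_all add: reflection_def inner_simps field_simps inner_commute)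
  ultimately show ?thesis by (simp add: orthogonal_transformation_def)
qed

definition reflection_form :: "real \<Rightarrow> 'a::euclidean_space \<Rightarrow> 'a \<Rightarrow> 'a \<Rightarrow> real" where
  "reflection_form k x y a = k * (a \<bullet> a) - 4 * (a \<bullet> x) * (a \<bullet> y)"

lemma norm_add_reflection:
  "((norm (x + reflection a y))\<^sup>2 - s\<^sup>2) * (a \<bullet> a) = reflection_form ((norm (x + y))\<^sup>2 - s\<^sup>2) x y a"
proof (cases "a = 0")
  case False
  have "(norm (x + reflection a y))\<^sup>2 = x \<bullet> x + y \<bullet> y + 2 * (x \<bullet> reflection a y)"
    using orthogonal_transformation_reflection[of a]
    by (simp add: orthogonal_transformation_def power2_norm_eq_inner inner_simps inner_commute)
  with False show ?thesis
    by (simp add: reflection_def reflection_form_def power2_norm_eq_inner inner_simps inner_commute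
        field_simps)
qed (simp add: reflection_form_def)

lemma real_polynomial_function_inner_self:
  "real_polynomial_function (\<lambda>a::'a::euclidean_space. a \<bullet> a)"
proof -
  have "(\<lambda>a::'a. a \<bullet> a) = (\<lambda>a. \<Sum>b\<in>Basis. (a \<bullet> b) * (a \<bullet> b))"
    by (rule ext) (rule euclidean_inner)
  moreover have "real_polynomial_function (\<lambda>a::'a. \<Sum>b\<in>Basis. (a \<bullet> b) * (a \<bullet> b))"
    by (intro real_polynomial_function_sum real_polynomial_function.intros
        bounded_linear_inner_left) simp
  ultimately show ?thesis by simp
qed

lemma real_polynomial_reflection_form: "real_polynomial_function (reflection_form k x y)"
  unfolding reflection_form_def
  by (intro real_polynomial_function_diff real_polynomial_function.intros
      real_polynomial_function_inner_self bounded_linear_inner_left)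

lemma exists_reflection_form_nonzero:
  fixes x y :: "'a::euclidean_space"
  assumes dim: "2 \<le> DIM('a)" and "x \<noteq> 0" "y \<noteq> 0"
  shows "\<exists>a. reflection_form k x y a \<noteq> 0"
proof (cases "k = 0")
  case False
  obtain a where "a \<noteq> 0" "orthogonal x a" using orthogonal_to_vector_exists[OF dim] by blast
  then have "reflection_form k x y a \<noteq> 0"
    using False by (simp add: reflection_form_def orthogonal_def inner_commute)
  then show ?thesis ..
next
  case True
  define a where "a = (if x \<bullet> y = 0 then x + y else x)"
  have "a \<bullet> x \<noteq> 0" "a \<bullet> y \<noteq> 0"
    using assms(2,3) by (auto simp: a_def inner_simps inner_commute)
  then show ?thesis using True by (intro exI[of _ a]) (simp add: reflection_form_def)
qed

lemma exists_generic_orthogonal_transformation: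
  fixes D E :: "'a::euclidean_space set"
  assumes dim: "2 \<le> DIM('a)" and fin: "finite D" "finite E" "finite S" and "0 \<notin> D" "0 \<notin> E"
  shows "\<exists>R. orthogonal_transformation R \<and> (\<forall>x\<in>D. \<forall>y\<in>E. norm (x + R y) \<notin> S)"
proof -
  define Q where "Q = (\<lambda>(x, y, s). reflection_form ((norm (x + y))\<^sup>2 - s\<^sup>2) x y) ` (D \<times> E \<times> S)"
  have "\<exists>a. reflection_form k x y a \<noteq> 0" if "x \<in> D" "y \<in> E" for k x y
    using that assms(5,6) by (intro exists_reflection_form_nonzero[OF dim]) auto
  then have "\<forall>q\<in>Q. real_polynomial_function q \<and> (\<exists>a. q a \<noteq> 0)"
    by (auto simp: Q_def real_polynomial_reflection_form)
  moreover have "finite Q" using fin by (simp add: Q_def)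
  ultimately obtain a where nonroot: "\<forall>q\<in>Q. q a \<noteq> 0" using exists_common_nonroot by blast
  have "norm (x + reflection a y) \<noteq> s" if "x \<in> D" "y \<in> E" "s \<in> S" for x y s
  proof -
    have "reflection_form ((norm (x + y))\<^sup>2 - s\<^sup>2) x y a \<noteq> 0"
      using nonroot that by (force simp: Q_def)
    then show ?thesis unfolding norm_add_reflection[symmetric] by auto
  qed
  then show ?thesis using orthogonal_transformation_reflection by blast
qed

definition grid :: "nat \<Rightarrow> 'a set \<Rightarrow> (nat \<Rightarrow> 'a) set" where
  "grid N X = {..<N} \<rightarrow>\<^sub>E X"

definition diff_coords :: "nat \<Rightarrow> (nat \<Rightarrow> 'a) \<Rightarrow> (nat \<Rightarrow> 'a) \<Rightarrow> nat set" where
  "diff_coords N x y = {i. i < N \<and> x i \<noteq> y i}"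

lemma finite_grid: "finite X \<Longrightarrow> finite (grid N X)"
  by (simp add: grid_def finite_PiE)

lemma card_grid: "finite X \<Longrightarrow> card (grid N X) = card X ^ N"
  by (simp add: grid_def card_PiE)

lemma grid_mem: "x \<in> grid N X \<Longrightarrow> j < N \<Longrightarrow> x j \<in> X"
  by (auto simp: grid_def)

lemma grid_upd: "z \<in> grid N X \<Longrightarrow> j < N \<Longrightarrow> p \<in> X \<Longrightarrow> z(j := p) \<in> grid N X"
  by (auto simp: grid_def PiE_iff extensional_def)

lemma grid_eqI: "x \<in> grid N X \<Longrightarrow> y \<in> grid N Y \<Longrightarrow> (\<And>i. i < N \<Longrightarrow> x i = y i) \<Longrightarrow> x = y"
  unfolding grid_def by (rule extensionalityI[of _ "{..<N}"]) (auto simp: PiE_def)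

lemma finite_diff_coords [simp]: "finite (diff_coords N x y)"
  by (simp add: diff_coords_def)

lemma diff_coords_eq_empty_iff:
  "x \<in> grid N X \<Longrightarrow> y \<in> grid N Y \<Longrightarrow> diff_coords N x y = {} \<longleftrightarrow> x = y"
  by (auto simp: diff_coords_def intro: grid_eqI)

definition generic_grid_map :: "nat \<Rightarrow> 'a::real_normed_vector set \<Rightarrow> ((nat \<Rightarrow> 'a) \<Rightarrow> 'a) \<Rightarrow> bool" where
  "generic_grid_map N X \<phi> \<longleftrightarrow> inj_on \<phi> (grid N X) \<and>
     (\<forall>z j p q. j < N \<longrightarrow> norm (\<phi> (z(j := p)) - \<phi> (z(j := q))) = norm (p - q)) \<and>
     (\<forall>x\<in>grid N X. \<forall>y\<in>grid N X. 2 \<le> card (diff_coords N x y) \<longrightarrow> norm (\<phi> x - \<phi> y) \<noteq> 1)"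

lemma
  assumes "generic_grid_map N X \<phi>"
  shows generic_grid_map_inj_on: "inj_on \<phi> (grid N X)"
    and generic_grid_map_line: "j < N \<Longrightarrow> norm (\<phi> (z(j := p)) - \<phi> (z(j := q))) = norm (p - q)"
    and generic_grid_map_off_line:
      "\<lbrakk>x \<in> grid N X; y \<in> grid N X; 2 \<le> card (diff_coords N x y)\<rbrakk> \<Longrightarrow> norm (\<phi> x - \<phi> y) \<noteq> 1"
  using assms unfolding generic_grid_map_def by blast+

lemma unit_embedding_line:
  assumes generic: "generic_grid_map N X \<phi>" and coord: "j < N" and unit: "unit_embedding ind H g"
  shows "unit_embedding ind H (\<lambda>w. \<phi> (z(j := g w)))"
proof -
  have norm_eq: "norm (\<phi> (z(j := g x)) - \<phi> (z(j := g y))) = norm (g x - g y)" for x y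
    by (rule generic_grid_map_line[OF generic coord])
  have "\<phi> (z(j := g x)) = \<phi> (z(j := g y)) \<longleftrightarrow> g x = g y" for x y
    using norm_eq[of x y] by (metis norm_eq_zero right_minus_eq)
  then show ?thesis using unit unfolding unit_embedding_def norm_eq inj_on_def by simp
qed

definition extend_grid_map ::
  "nat \<Rightarrow> ((nat \<Rightarrow> 'a) \<Rightarrow> 'a) \<Rightarrow> ('a \<Rightarrow> 'a) \<Rightarrow> (nat \<Rightarrow> 'a) \<Rightarrow> 'a::real_normed_vector" where
  "extend_grid_map N \<phi> R x = \<phi> (restrict x {..<N}) + R (x N)"

lemma extend_grid_map_diff:
  assumes "linear R"
  shows "extend_grid_map N \<phi> R x - extend_grid_map N \<phi> R y =
    \<phi> (restrict x {..<N}) - \<phi> (restrict y {..<N}) + R (x N - y N)"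
  by (simp add: extend_grid_map_def linear_diff[OF assms])

lemma restrict_grid: "x \<in> grid (Suc N) X \<Longrightarrow> restrict x {..<N} \<in> grid N X"
  by (auto simp: grid_def PiE_iff)

lemma diff_coords_Suc:
  "diff_coords (Suc N) x y =
    diff_coords N (restrict x {..<N}) (restrict y {..<N}) \<union> (if x N = y N then {} else {N})"
  by (auto simp: diff_coords_def less_Suc_eq)

lemma extend_grid_map_line:
  fixes \<phi> :: "(nat \<Rightarrow> 'a::euclidean_space) \<Rightarrow> 'a"
  assumes map: "generic_grid_map N X \<phi>" and orth: "orthogonal_transformation R" and "j < Suc N"
  shows "norm (extend_grid_map N \<phi> R (z(j := p)) - extend_grid_map N \<phi> R (z(j := q))) =
    norm (p - q)"
proof (cases "j = N")
  case True
  then have "restrict (z(j := p)) {..<N} = restrict (z(j := q)) {..<N}" by auto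
  then show ?thesis
    unfolding extend_grid_map_diff[OF orthogonal_transformation_linear[OF orth]]
    by (simp add: True orthogonal_transformation_norm[OF orth])
next
  case False
  then have "restrict (z(j := t)) {..<N} = (restrict z {..<N})(j := t)" for t
    using assms(3) by auto
  then show ?thesis
    using False assms(3) generic_grid_map_line[OF map, of j]
    by (simp add: extend_grid_map_def)
qed

lemma extend_grid_map_apart:
  fixes \<phi> :: "(nat \<Rightarrow> 'a::euclidean_space) \<Rightarrow> 'a"
  assumes map: "generic_grid_map N X \<phi>" and orth: "orthogonal_transformation R"
    and generic: "\<And>x y p q. \<lbrakk>x \<in> grid N X; y \<in> grid N X; x \<noteq> y; p \<in> X; q \<in> X; p \<noteq> q\<rbrakk> \<Longrightarrow>
      norm (\<phi> x - \<phi> y + R (p - q)) \<notin> {0, 1}"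
    and x: "x \<in> grid (Suc N) X" and y: "y \<in> grid (Suc N) X" and "x \<noteq> y"
  defines "gap \<equiv> norm (extend_grid_map N \<phi> R x - extend_grid_map N \<phi> R y)"
  shows "gap \<noteq> 0" "2 \<le> card (diff_coords (Suc N) x y) \<Longrightarrow> gap \<noteq> 1"
proof -
  define x' y' where "x' = restrict x {..<N}" and "y' = restrict y {..<N}"
  have x': "x' \<in> grid N X" and y': "y' \<in> grid N X"
    using restrict_grid[OF x] restrict_grid[OF y] by (simp_all add: x'_def y'_def)
  have gap: "gap = norm (\<phi> x' - \<phi> y' + R (x N - y N))"
    unfolding gap_def x'_def y'_def
    by (simp add: extend_grid_map_diff[OF orthogonal_transformation_linear[OF orth]])
  have coords: "diff_coords (Suc N) x y = diff_coords N x' y' \<union> (if x N = y N then {} else {N})"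
    unfolding x'_def y'_def by (rule diff_coords_Suc)
  have R_zero: "R 0 = 0" by (rule linear_0[OF orthogonal_transformation_linear[OF orth]])
  have "gap \<noteq> 0 \<and> (2 \<le> card (diff_coords (Suc N) x y) \<longrightarrow> gap \<noteq> 1)"
  proof (cases "x N = y N"; cases "x' = y'")
    assume "x N = y N" "x' = y'"
    then have "diff_coords (Suc N) x y = {}" unfolding coords by (simp add: diff_coords_def)
    then show ?thesis using diff_coords_eq_empty_iff[OF x y] \<open>x \<noteq> y\<close> by simp
  next
    assume same: "x N = y N" and "x' \<noteq> y'"
    then have "\<phi> x' \<noteq> \<phi> y'" using inj_onD[OF generic_grid_map_inj_on[OF map]] x' y' by blast
    then show ?thesis
      using generic_grid_map_off_line[OF map x' y'] unfolding gap coords by (simp add: same R_zero)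
  next
    assume "x N \<noteq> y N" "x' = y'"
    then show ?thesis
      unfolding gap coords by (simp add: orthogonal_transformation_norm[OF orth] diff_coords_def)
  next
    assume "x N \<noteq> y N" "x' \<noteq> y'"
    then show ?thesis
      using generic[OF x' y' _ grid_mem[OF x] grid_mem[OF y]] unfolding gap by simp
  qed
  then show "gap \<noteq> 0" "2 \<le> card (diff_coords (Suc N) x y) \<Longrightarrow> gap \<noteq> 1" by blast+
qed

lemma generic_extend_grid_map:
  fixes \<phi> :: "(nat \<Rightarrow> 'a::euclidean_space) \<Rightarrow> 'a"
  assumes map: "generic_grid_map N X \<phi>" and orth: "orthogonal_transformation R"
    and generic: "\<And>x y p q. \<lbrakk>x \<in> grid N X; y \<in> grid N X; x \<noteq> y; p \<in> X; q \<in> X; p \<noteq> q\<rbrakk> \<Longrightarrow>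
      norm (\<phi> x - \<phi> y + R (p - q)) \<notin> {0, 1}"
  shows "generic_grid_map (Suc N) X (extend_grid_map N \<phi> R)"
  unfolding generic_grid_map_def
proof (intro conjI ballI allI impI)
  show "inj_on (extend_grid_map N \<phi> R) (grid (Suc N) X)"
  proof (rule inj_onI, rule ccontr)
    fix x y
    assume xy: "x \<in> grid (Suc N) X" "y \<in> grid (Suc N) X" "x \<noteq> y"
      and same: "extend_grid_map N \<phi> R x = extend_grid_map N \<phi> R y"
    have "norm (extend_grid_map N \<phi> R x - extend_grid_map N \<phi> R y) \<noteq> 0"
      by (rule extend_grid_map_apart(1)[OF map orth generic xy])
    then show False using same by simp
  qed
  show "norm (extend_grid_map N \<phi> R x - extend_grid_map N \<phi> R y) \<noteq> 1"
    if "x \<in> grid (Suc N) X" "y \<in> grid (Suc N) X"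
      and far: "2 \<le> card (diff_coords (Suc N) x y)" for x y
  proof -
    have "x \<noteq> y" using far by (auto simp: diff_coords_def)
    with that show ?thesis by (intro extend_grid_map_apart(2)[OF map orth generic])
  qed
qed (rule extend_grid_map_line[OF map orth])

lemma exists_generic_grid_map:
  fixes X :: "'a::euclidean_space set"
  assumes dim: "2 \<le> DIM('a)" and fin: "finite X"
  shows "\<exists>\<phi>. generic_grid_map N X \<phi>"
proof (induction N)
  case 0
  have "generic_grid_map 0 X (\<lambda>_. 0)" by (simp add: generic_grid_map_def grid_def diff_coords_def)
  then show ?case by blast
next
  case (Suc N)
  then obtain \<phi> where generic: "generic_grid_map N X \<phi>" ..
  define D where "D = (\<lambda>(x, y). \<phi> x - \<phi> y) ` (grid N X \<times> grid N X) - {0}"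
  define E where "E = (\<lambda>(p, q). p - q) ` (X \<times> X) - {0}"
  have "finite D" "finite E" using fin finite_grid[OF fin] by (simp_all add: D_def E_def)
  moreover have "0 \<notin> D" "0 \<notin> E" by (simp_all add: D_def E_def)
  ultimately obtain R where R: "orthogonal_transformation R" "\<forall>x\<in>D. \<forall>y\<in>E. norm (x + R y) \<notin> {0, 1}"
    using exists_generic_orthogonal_transformation[OF dim, of D E "{0, 1}"] by auto
  have "norm (\<phi> x - \<phi> y + R (p - q)) \<notin> {0, 1}"
    if "x \<in> grid N X" "y \<in> grid N X" "x \<noteq> y" "p \<in> X" "q \<in> X" "p \<noteq> q" for x y p q
  proof -
    have "\<phi> x - \<phi> y \<in> D" "p - q \<in> E"
      using that inj_onD[OF generic_grid_map_inj_on[OF generic]] by (auto simp: D_def E_def)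
    then show ?thesis using R(2) by blast
  qed
  then show ?case using generic_extend_grid_map[OF generic R(1)] by blast
qed

section \<open>Subcubes of grids\<close>

lemma cube_verts_eq_grid: "cube_verts N = grid N {0, 1}"
  by (simp add: cube_verts_def grid_def)

lemma finite_edges_hypercube: "finite (edges (hypercube N))"
proof (rule finite_subset)
  show "edges (hypercube N) \<subseteq> Pow (cube_verts N)" by (auto simp: hypercube_def)
qed (simp add: cube_verts_eq_grid finite_grid)

lemma edge_hypercube_iff:
  assumes "x \<in> cube_verts N" "y \<in> cube_verts N"
  shows "{x, y} \<in> edges (hypercube N) \<longleftrightarrow> card (diff_coords N x y) = 1"
proof -
  have "diff_coords N x y = diff_coords N y x" for x y :: "nat \<Rightarrow> nat"
    by (auto simp: diff_coords_def)
  then show ?thesis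
    using assms by (auto simp: hypercube_def doubleton_eq_iff simp flip: diff_coords_def)
qed

definition up_edges :: "nat \<Rightarrow> (nat \<times> (nat \<Rightarrow> nat)) set" where
  "up_edges N = {(j, \<epsilon>). j < N \<and> \<epsilon> \<in> cube_verts N \<and> \<epsilon> j = 0}"

definition up_edge :: "nat \<times> (nat \<Rightarrow> nat) \<Rightarrow> (nat \<Rightarrow> nat) set" where
  "up_edge = (\<lambda>(j, \<epsilon>). {\<epsilon>, \<epsilon>(j := 1)})"

lemma
  assumes "(j, \<epsilon>) \<in> up_edges N"
  shows up_edges_coord: "j < N" "\<epsilon> j = 0"
    and up_edges_cube_verts: "\<epsilon> \<in> cube_verts N" "\<epsilon>(j := 1) \<in> cube_verts N"
  using assms by (auto simp: up_edges_def cube_verts_eq_grid intro: grid_upd)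

lemma finite_up_edges: "finite (up_edges N)"
  by (rule finite_subset[of _ "{..<N} \<times> cube_verts N"])
    (auto simp: up_edges_def cube_verts_eq_grid finite_grid)

lemma inj_on_up_edge: "inj_on up_edge (up_edges N)"
proof (rule inj_onI, clarify)
  fix j \<epsilon> j' \<epsilon>'
  assume mem: "(j, \<epsilon>) \<in> up_edges N" "(j', \<epsilon>') \<in> up_edges N"
    and same_edge: "up_edge (j, \<epsilon>) = up_edge (j', \<epsilon>')"
  note zero = up_edges_coord(2)[OF mem(1)] up_edges_coord(2)[OF mem(2)]
  from same_edge consider (same) "\<epsilon> = \<epsilon>'" "\<epsilon>(j := 1) = \<epsilon>'(j' := 1)"
    | (swapped) "\<epsilon> = \<epsilon>'(j' := 1)" "\<epsilon>(j := 1) = \<epsilon>'"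
    by (auto simp: up_edge_def doubleton_eq_iff)
  then show "j = j' \<and> \<epsilon> = \<epsilon>'"
  proof cases
    case same
    then have "(\<epsilon>(j' := 1)) j = 1" by (metis fun_upd_same)
    then show ?thesis using same zero by (auto split: if_splits)
  next
    case swapped
    have "\<epsilon> j' = 1" by (simp add: swapped(1))
    moreover have "(\<epsilon>(j := 1)) j' = 0" unfolding swapped(2) by (rule zero)
    ultimately show ?thesis by (auto split: if_splits)
  qed
qed

lemma up_edge_mem_edges_hypercube:
  assumes "(j, \<epsilon>) \<in> up_edges N"
  shows "up_edge (j, \<epsilon>) \<in> edges (hypercube N)"
proof -
  have "diff_coords N \<epsilon> (\<epsilon>(j := 1)) = {j}"
    using up_edges_coord[OF assms] by (auto simp: diff_coords_def)
  then show ?thesis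
    using edge_hypercube_iff[OF up_edges_cube_verts[OF assms]] by (simp add: up_edge_def)
qed

lemma edge_hypercube_up_edge:
  assumes "e \<in> edges (hypercube N)"
  shows "\<exists>j \<epsilon>. (j, \<epsilon>) \<in> up_edges N \<and> e = up_edge (j, \<epsilon>)"
proof -
  obtain x y where ends: "e = {x, y}" and xy: "x \<in> grid N {0, 1}" "y \<in> grid N {0, 1}"
    and "card (diff_coords N x y) = 1"
    using assms by (auto simp: hypercube_def diff_coords_def cube_verts_eq_grid)
  then obtain j where coord: "diff_coords N x y = {j}" by (auto simp: card_1_singleton_iff)
  then have "j < N" "x j \<noteq> y j" by (auto simp: diff_coords_def)
  moreover have "x j \<in> {0, 1}" "y j \<in> {0, 1}" using xy \<open>j < N\<close> by (auto dest: grid_mem)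
  ultimately consider (up) "x j = 0" "y j = 1" | (down) "x j = 1" "y j = 0" by auto
  moreover have same: "x i = y i" if "i < N" "i \<noteq> j" for i
    using coord that by (auto simp: diff_coords_def)
  ultimately show ?thesis
  proof cases
    case up
    then have "x(j := 1) = y"
      using xy same \<open>j < N\<close> by (intro grid_eqI[OF grid_upd]) auto
    then show ?thesis using up xy \<open>j < N\<close>
      by (intro exI[of _ j] exI[of _ x])
        (auto simp: ends up_edge_def up_edges_def cube_verts_eq_grid)
  next
    case down
    then have "y(j := 1) = x"
      using xy same \<open>j < N\<close> by (intro grid_eqI[OF grid_upd]) auto
    then show ?thesis using down xy \<open>j < N\<close>
      by (intro exI[of _ j] exI[of _ y])
        (auto simp: ends up_edge_def up_edges_def cube_verts_eq_grid)
  qed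
qed

lemma bij_betw_up_edge: "bij_betw up_edge (up_edges N) (edges (hypercube N))"
proof (rule bij_betw_imageI[OF inj_on_up_edge])
  show "up_edge ` up_edges N = edges (hypercube N)"
  proof
    show "up_edge ` up_edges N \<subseteq> edges (hypercube N)" using up_edge_mem_edges_hypercube by auto
    show "edges (hypercube N) \<subseteq> up_edge ` up_edges N" using edge_hypercube_up_edge by blast
  qed
qed

lemma card_edges_hypercube: "card (edges (hypercube N)) = card (up_edges N)"
  using bij_betw_same_card[OF bij_betw_up_edge] by simp

lemma card_edges_hypercube_pos:
  assumes "0 < N"
  shows "0 < card (edges (hypercube N))"
proof -
  have "(0, \<lambda>i\<in>{..<N}. 0) \<in> up_edges N" using assms by (auto simp: up_edges_def cube_verts_def)
  then show ?thesis unfolding card_edges_hypercube using finite_up_edges card_gt_0_iff by blast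
qed

lemma layer_up:
  assumes "(j, \<epsilon>) \<in> up_edges N" "\<epsilon> \<in> layer N k"
  shows "\<epsilon>(j := 1) \<in> layer N (Suc k)"
proof -
  have "{i. i < N \<and> (\<epsilon>(j := 1)) i = 1} = insert j {i. i < N \<and> \<epsilon> i = 1}"
    using up_edges_coord[OF assms(1)] by auto
  moreover have "card (insert j {i. i < N \<and> \<epsilon> i = 1}) = Suc (card {i. i < N \<and> \<epsilon> i = 1})"
    using up_edges_coord[OF assms(1)] by (intro card_insert_disjoint) auto
  ultimately show ?thesis
    using assms(2) up_edges_cube_verts[OF assms(1)] unfolding layer_def by simp
qed

lemma up_edge_between_layers:
  assumes up: "(j, \<epsilon>) \<in> up_edges N" and xy: "{x, y} = up_edge (j, \<epsilon>)"
    and layers: "x \<in> layer N (Suc k)" "y \<in> layer N k"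
  shows "y = \<epsilon>" "x = \<epsilon>(j := 1)"
proof -
  have "\<not> (x = \<epsilon> \<and> y = \<epsilon>(j := 1))"
    using layer_up[OF up, of "Suc k"] layers by (auto simp: layer_def)
  then show "y = \<epsilon>" "x = \<epsilon>(j := 1)" using xy by (auto simp: up_edge_def doubleton_eq_iff)
qed

definition subcube :: "nat \<Rightarrow> (nat \<Rightarrow> 'a \<times> 'a) \<Rightarrow> (nat \<Rightarrow> nat) \<Rightarrow> nat \<Rightarrow> 'a" where
  "subcube N s \<epsilon> = (\<lambda>j\<in>{..<N}. if \<epsilon> j = 1 then fst (s j) else snd (s j))"

lemma subcube_in_grid:
  assumes s_grid: "s \<in> grid N P" and "P \<subseteq> X \<times> X"
  shows "subcube N s \<epsilon> \<in> grid N X"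
proof -
  have "s j \<in> X \<times> X" if "j < N" for j using grid_mem[OF s_grid that] assms(2) by blast
  then show ?thesis by (auto simp: subcube_def grid_def mem_Times_iff)
qed

lemma
  assumes "(j, \<epsilon>) \<in> up_edges N"
  shows subcube_up: "subcube N s (\<epsilon>(j := 1)) = (subcube N s \<epsilon>)(j := fst (s j))"
    and subcube_down: "subcube N s \<epsilon> = (subcube N s \<epsilon>)(j := snd (s j))"
    and subcube_upd: "subcube N (s(j := t)) \<epsilon> = (subcube N s \<epsilon>)(j := snd t)"
  using up_edges_coord[OF assms] by (auto simp: subcube_def fun_eq_iff)

lemma diff_coords_subcube:
  assumes "\<epsilon> \<in> cube_verts N" "\<epsilon>' \<in> cube_verts N" and "\<And>j. j < N \<Longrightarrow> fst (s j) \<noteq> snd (s j)"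
  shows "diff_coords N (subcube N s \<epsilon>) (subcube N s \<epsilon>') = diff_coords N \<epsilon> \<epsilon>'"
proof -
  have "\<epsilon> i \<in> {0, 1}" "\<epsilon>' i \<in> {0, 1}" if "i < N" for i
    using assms(1,2) that by (auto simp: cube_verts_eq_grid dest: grid_mem)
  then have "\<epsilon> i \<noteq> \<epsilon>' i \<longleftrightarrow> (\<epsilon> i = 1) \<noteq> (\<epsilon>' i = 1)" if "i < N" for i
    using that by fastforce
  then show ?thesis
    using assms(3) assms(3)[THEN not_sym] unfolding diff_coords_def subcube_def by auto
qed

lemma inj_on_subcube:
  assumes "\<And>j. j < N \<Longrightarrow> fst (s j) \<noteq> snd (s j)"
  shows "inj_on (subcube N s) (cube_verts N)"
proof (rule inj_onI)
  fix x y assume xy: "x \<in> cube_verts N" "y \<in> cube_verts N" "subcube N s x = subcube N s y"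
  then have "diff_coords N x y = {}"
    using diff_coords_subcube[of x N y s] assms by (auto simp: diff_coords_def)
  then show "x = y" using xy(1,2) by (simp add: cube_verts_eq_grid diff_coords_eq_empty_iff)
qed

lemma off_subcube:
  assumes "j < N" "p \<notin> {fst (s j), snd (s j)}"
  shows "z(j := p) \<noteq> subcube N s \<epsilon>"
proof
  assume "z(j := p) = subcube N s \<epsilon>"
  then have "p = subcube N s \<epsilon> j" by (metis fun_upd_same)
  then show False using assms by (auto simp: subcube_def split: if_splits)
qed

lemma up_edge_eq_if_common_point:
  assumes up: "(j, \<epsilon>) \<in> up_edges N" "(j', \<epsilon>') \<in> up_edges N"
    and distinct: "\<And>j. j < N \<Longrightarrow> fst (s j) \<noteq> snd (s j)"
    and off: "p \<notin> {fst (s j), snd (s j)}" "p' \<notin> {fst (s j'), snd (s j')}"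
    and common: "(subcube N s \<epsilon>)(j := p) = (subcube N s \<epsilon>')(j' := p')"
  shows "j = j' \<and> \<epsilon> = \<epsilon>'"
proof -
  have "j = j'"
  proof (rule ccontr)
    assume "j \<noteq> j'"
    then have "p = subcube N s \<epsilon>' j" using fun_cong[OF common, of j] by simp
    then show False
      using off(1) up_edges_coord(1)[OF up(1)] by (auto simp: subcube_def split: if_splits)
  qed
  then have "(subcube N s \<epsilon>)(j := snd (s j)) = (subcube N s \<epsilon>')(j' := snd (s j'))"
    using common by (metis fun_upd_upd)
  then have "subcube N s \<epsilon> = subcube N s \<epsilon>'"
    using subcube_down[OF up(1), of s] subcube_down[OF up(2), of s] by simp
  then have "\<epsilon> = \<epsilon>'"
    using inj_on_subcube[of N s, OF distinct] up_edges_cube_verts(1)[OF up(1)]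
      up_edges_cube_verts(1)[OF up(2)]
    by (auto dest: inj_onD)
  with \<open>j = j'\<close> show ?thesis ..
qed

lemma unit_embedding_subcube:
  assumes generic: "generic_grid_map N X \<phi>"
    and s_grid: "s \<in> grid N {(p, q) \<in> X \<times> X. norm (p - q) = 1}"
  shows "unit_embedding True (hypercube N) (\<phi> \<circ> subcube N s)"
proof -
  have unit: "norm (fst (s j) - snd (s j)) = 1" if "j < N" for j
    using grid_mem[OF s_grid that] by auto
  then have distinct: "fst (s j) \<noteq> snd (s j)" if "j < N" for j using that by fastforce
  have in_grid: "subcube N s \<epsilon> \<in> grid N X" for \<epsilon> using subcube_in_grid[OF s_grid] by blast
  have "norm (\<phi> (subcube N s x) - \<phi> (subcube N s y)) = 1"
    if edge: "{x, y} \<in> edges (hypercube N)" for x y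
  proof -
    obtain j \<epsilon> where up: "(j, \<epsilon>) \<in> up_edges N" and xy: "{x, y} = {\<epsilon>, \<epsilon>(j := 1)}"
      using edge_hypercube_up_edge[OF edge] by (auto simp: up_edge_def)
    have "norm (\<phi> (subcube N s (\<epsilon>(j := 1))) - \<phi> (subcube N s \<epsilon>)) = 1"
      using generic_grid_map_line[OF generic up_edges_coord(1)[OF up]]
        unit[OF up_edges_coord(1)[OF up]]
      by (metis subcube_up[OF up] subcube_down[OF up])
    then show ?thesis using xy by (auto simp: doubleton_eq_iff norm_minus_commute)
  qed
  moreover have "norm (\<phi> (subcube N s x) - \<phi> (subcube N s y)) \<noteq> 1"
    if xy: "x \<in> cube_verts N" "y \<in> cube_verts N" "{x, y} \<notin> edges (hypercube N)" for x y
  proof (cases "x = y")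
    case False
    have "card (diff_coords N x y) \<noteq> 1" using xy edge_hypercube_iff by blast
    moreover have "card (diff_coords N x y) \<noteq> 0"
      using False xy by (simp add: cube_verts_eq_grid diff_coords_eq_empty_iff)
    ultimately have "2 \<le> card (diff_coords N x y)" by linarith
    then have "2 \<le> card (diff_coords N (subcube N s x) (subcube N s y))"
      using diff_coords_subcube[OF xy(1,2), of s] distinct by simp
    then show ?thesis using generic_grid_map_off_line[OF generic in_grid in_grid] by blast
  qed simp
  moreover have "inj_on (\<phi> \<circ> subcube N s) (cube_verts N)"
    using generic_grid_map_inj_on[OF generic] in_grid
    by (intro comp_inj_on inj_on_subcube[OF distinct]) (auto intro: inj_on_subset)
  ultimately show ?thesis by (simp add: unit_embedding_def) (simp add: hypercube_def)
qed

lemma double_counting_average: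
  assumes "finite S" "S \<noteq> {}" "finite E" and deg: "\<And>e. e \<in> E \<Longrightarrow> card S \<le> m * card {s\<in>S. R s e}"
  shows "\<exists>s\<in>S. card E \<le> m * card {e\<in>E. R s e}"
proof (rule ccontr)
  assume "\<not> ?thesis"
  then have "(\<Sum>s\<in>S. m * card {e\<in>E. R s e}) < (\<Sum>s\<in>S. card E)"
    using assms by (intro sum_strict_mono) (auto simp: not_le)
  also have "\<dots> = (\<Sum>e\<in>E. card S)" by simp
  also have "\<dots> \<le> (\<Sum>e\<in>E. m * card {s\<in>S. R s e})" by (rule sum_mono[OF deg])
  also have "\<dots> = (\<Sum>s\<in>S. m * card {e\<in>E. R s e})"
    using sum_multicount_gen[OF assms(1,3), of R "\<lambda>e. card {s\<in>S. R s e}"]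
    by (simp flip: sum_distrib_left)
  finally show False by simp
qed

text \<open>A random \<open>s\<close> makes each edge of the cube good with probability at least \<open>1 / card P\<close>:
  whatever \<open>s\<close> is outside \<open>j\<close>, some value of \<open>s j\<close> works.\<close>

lemma exists_dense_subcube:
  fixes P :: "('a \<times> 'a) set"
  assumes pairs: "finite P" "P \<noteq> {}" "P \<subseteq> X \<times> X"
    and line: "\<And>j z. j < N \<Longrightarrow> z \<in> grid N X \<Longrightarrow> \<exists>(p, q)\<in>P. Good j (z(j := p)) (z(j := q))"
  shows "\<exists>s\<in>grid N P. card (up_edges N) \<le>
    card P * card {(j, \<epsilon>) \<in> up_edges N. Good j (subcube N s (\<epsilon>(j := 1))) (subcube N s \<epsilon>)}"
proof -
  define good where "good = (\<lambda>s (j, \<epsilon>). Good j (subcube N s (\<epsilon>(j := 1))) (subcube N s \<epsilon>))"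
  have fin: "finite (grid N P)" by (rule finite_grid[OF pairs(1)])
  have "card (grid N P) \<le> card P * card {s\<in>grid N P. good s e}" if mem: "e \<in> up_edges N" for e
  proof -
    obtain j \<epsilon> where e: "e = (j, \<epsilon>)" and up: "(j, \<epsilon>) \<in> up_edges N" using mem by (cases e) auto
    note coord = up_edges_coord(1)[OF up]
    have "\<exists>t\<in>P. good (s(j := t)) e" if s: "s \<in> grid N P" for s
    proof -
      obtain p q where "(p, q) \<in> P" "Good j ((subcube N s \<epsilon>)(j := p)) ((subcube N s \<epsilon>)(j := q))"
        using line[OF coord subcube_in_grid[OF s pairs(3)]] by blast
      then show ?thesis
        by (intro bexI[of _ "(p, q)"])
          (simp_all add: good_def e subcube_up[OF up] subcube_upd[OF up] del: One_nat_def)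
    qed
    then obtain t where t: "\<And>s. s \<in> grid N P \<Longrightarrow> t s \<in> P \<and> good (s(j := t s)) e" by metis
    have "inj_on (\<lambda>s. (s(j := t s), s j)) (grid N P)"
      by (rule inj_onI) (metis fun_upd_triv fun_upd_upd prod.inject)
    moreover have "(\<lambda>s. (s(j := t s), s j)) ` grid N P \<subseteq> {s\<in>grid N P. good s e} \<times> P"
      using t coord by (auto intro: grid_upd grid_mem)
    ultimately have "card (grid N P) \<le> card ({s\<in>grid N P. good s e} \<times> P)"
      using fin pairs(1) by (intro card_inj_on_le) auto
    then show ?thesis by (simp add: card_cartesian_product mult.commute)
  qed
  then have "\<exists>s\<in>grid N P. card (up_edges N) \<le> card P * card {e\<in>up_edges N. good s e}"
    using pairs fin
    by (intro double_counting_average finite_up_edges) (auto simp: grid_def PiE_eq_empty_iff)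
  moreover have "{e\<in>up_edges N. good s e} =
      {(j, \<epsilon>) \<in> up_edges N. Good j (subcube N s (\<epsilon>(j := 1))) (subcube N s \<epsilon>)}" for s
    by (auto simp: good_def)
  ultimately show ?thesis by simp
qed

definition zero_avoidance_density :: "(nat \<Rightarrow> (nat \<Rightarrow> nat) graph \<Rightarrow> bool) \<Rightarrow> bool" where
  "zero_avoidance_density Q \<longleftrightarrow>
     (\<lambda>N. real (Max {card (edges G) | G. subgraph G (hypercube N) \<and> \<not> Q N G}) /
          real (card (edges (hypercube N)))) \<longlonglongrightarrow> 0"

lemma zero_cube_density_iff:
  "zero_cube_density H \<longleftrightarrow> zero_avoidance_density (\<lambda>N G. contains_copy G H)"
  unfolding zero_cube_density_def cube_ex_def zero_avoidance_density_def ..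

lemma zero_induced_cube_density_iff:
  "zero_induced_cube_density H \<longleftrightarrow> zero_avoidance_density (\<lambda>N G. contains_induced_copy G H)"
  unfolding zero_induced_cube_density_def cube_ex_ind_def zero_avoidance_density_def ..

lemma zero_strong_cube_density_imp:
  "zero_strong_cube_density \<Gamma> A B \<Longrightarrow> zero_avoidance_density (\<lambda>N G. contains_layered_copy N G \<Gamma> A B)"
  unfolding zero_strong_cube_density_def cube_ex_strong_def zero_avoidance_density_def
  by (rule smalloD_tendsto)

lemma zero_avoidance_density_dense_cube:
  assumes density: "zero_avoidance_density Q" and "0 < K"
  shows "\<exists>N. \<forall>G. subgraph G (hypercube N) \<longrightarrow>
    card (edges (hypercube N)) \<le> K * card (edges G) \<longrightarrow> Q N G"
proof -
  define sizes where "sizes N = {card (edges G) | G. subgraph G (hypercube N) \<and> \<not> Q N G}" for N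
  have "\<forall>\<^sub>F N in sequentially.
      real (Max (sizes N)) / real (card (edges (hypercube N))) < 1 / real K"
    using density \<open>0 < K\<close> unfolding zero_avoidance_density_def sizes_def
    by (intro order_tendstoD) auto
  then have "\<forall>\<^sub>F N in sequentially. 0 < N \<and>
      real (Max (sizes N)) / real (card (edges (hypercube N))) < 1 / real K"
    using eventually_gt_at_top[of 0] by eventually_elim auto
  then obtain N where "0 < N"
    "real (Max (sizes N)) / real (card (edges (hypercube N))) < 1 / real K"
    using eventually_happens'[OF sequentially_bot] by (metis (no_types, lifting))
  then have "real (K * Max (sizes N)) < real (card (edges (hypercube N)))"
    using card_edges_hypercube_pos[of N] \<open>0 < K\<close> by (simp add: field_simps)
  then have sparse: "K * Max (sizes N) < card (edges (hypercube N))" by (simp only: of_nat_less_iff)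
  have "sizes N \<subseteq> {..card (edges (hypercube N))}"
    by (auto simp: sizes_def subgraph_def intro!: card_mono finite_edges_hypercube)
  then have "finite (sizes N)" using finite_subset by blast
  have "Q N G"
    if G: "subgraph G (hypercube N)" "card (edges (hypercube N)) \<le> K * card (edges G)" for G
  proof (rule ccontr)
    assume "\<not> Q N G"
    then have "card (edges G) \<le> Max (sizes N)"
      using \<open>finite (sizes N)\<close> G(1) unfolding sizes_def by (intro Max_ge) blast+
    then have "K * card (edges G) \<le> K * Max (sizes N)" by simp
    then show False using sparse G(2) by linarith
  qed
  then show ?thesis by blast
qed

section \<open>Dense sets of monochromatic edges\<close>

definition mono_line_copy ::
  "bool \<Rightarrow> 'v graph \<Rightarrow> 'a::real_normed_vector set \<Rightarrow> ((nat \<Rightarrow> 'a) \<Rightarrow> nat) \<Rightarrow> nat \<Rightarrow>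
    nat \<Rightarrow> (nat \<Rightarrow> 'a) \<Rightarrow> ('v \<Rightarrow> 'a) \<Rightarrow> bool" where
  "mono_line_copy ind H X \<kappa> i j z g \<longleftrightarrow>
     unit_embedding ind H g \<and> g ` verts H \<subseteq> X \<and> (\<forall>w\<in>verts H. \<kappa> (z(j := g w)) = i)"

definition role_pairs :: "'v graph \<Rightarrow> 'v \<Rightarrow> 'v \<Rightarrow> 'a::real_normed_vector set \<Rightarrow> ('a \<times> 'a) set" where
  "role_pairs H u v X = {(g u, g v) | g. unit_embedding False H g \<and> g ` verts H \<subseteq> X}"

definition mono_edges ::
  "'v graph \<Rightarrow> 'v \<Rightarrow> 'v \<Rightarrow> 'a::real_normed_vector set \<Rightarrow> ((nat \<Rightarrow> 'a) \<Rightarrow> nat) \<Rightarrow> nat \<Rightarrow>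
    (nat \<Rightarrow> 'a \<times> 'a) \<Rightarrow> nat \<Rightarrow> (nat \<times> (nat \<Rightarrow> nat)) set" where
  "mono_edges H u v X \<kappa> N s i = {(j, \<epsilon>) \<in> up_edges N.
     \<exists>g. mono_line_copy False H X \<kappa> i j (subcube N s \<epsilon>) g \<and> (g u, g v) = s j}"

definition mono_verts ::
  "((nat \<Rightarrow> 'a) \<Rightarrow> nat) \<Rightarrow> nat \<Rightarrow> (nat \<Rightarrow> 'a \<times> 'a) \<Rightarrow> nat \<Rightarrow> (nat \<Rightarrow> nat) set" where
  "mono_verts \<kappa> N s i = {\<epsilon> \<in> cube_verts N. \<kappa> (subcube N s \<epsilon>) = i}"

lemma mono_line_copy_upd [simp]:
  "mono_line_copy ind H X \<kappa> i j (z(j := p)) g \<longleftrightarrow> mono_line_copy ind H X \<kappa> i j z g"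
  by (simp add: mono_line_copy_def)

lemma exists_mono_line_copy:
  assumes "arrows ind X H r" "verts H \<noteq> {}" and colouring: "\<kappa> \<in> UNIV \<rightarrow> {..<r}"
  shows "\<exists>g i. i < r \<and> mono_line_copy ind H X \<kappa> i j z g"
proof -
  have "(\<lambda>p. \<kappa> (z(j := p))) \<in> X \<rightarrow> {..<r}" using colouring by auto
  then obtain g where "unit_embedding ind H g" "g ` verts H \<subseteq> X"
    and "monochromatic (\<lambda>p. \<kappa> (z(j := p))) (g ` verts H)"
    using assms(1) unfolding arrows_def by blast
  then obtain i where copy: "mono_line_copy ind H X \<kappa> i j z g"
    by (auto simp: mono_line_copy_def monochromatic_def)
  obtain w where "w \<in> verts H" using assms(2) by blast
  then have "\<kappa> (z(j := g w)) = i" using copy by (simp add: mono_line_copy_def)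
  then have "i < r" using colouring by auto
  then show ?thesis using copy by blast
qed

lemma role_pairs_subset: "u \<in> verts H \<Longrightarrow> v \<in> verts H \<Longrightarrow> role_pairs H u v X \<subseteq> X \<times> X"
  by (auto simp: role_pairs_def)

lemma role_pairs_distinct:
  assumes "(p, q) \<in> role_pairs H u v X" "u \<in> verts H" "v \<in> verts H" "u \<noteq> v"
  shows "p \<noteq> q"
  using assms by (auto simp: role_pairs_def dest!: unit_embedding_inj_on inj_onD)

lemma role_pairs_single_edge:
  "role_pairs single_edge True False X = {(p, q) \<in> X \<times> X. norm (p - q) = 1}"
proof -
  have "\<exists>g. (p, q) = (g True, g False) \<and> norm (g True - g False) = 1 \<and> g ` verts single_edge \<subseteq> X"
    if "p \<in> X" "q \<in> X" "norm (p - q) = 1" for p q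
    using that by (intro exI[of _ "\<lambda>b. if b then p else q"]) simp
  then show ?thesis unfolding role_pairs_def unit_embedding_single_edge by auto
qed

lemma mono_edges_subset: "mono_edges H u v X \<kappa> N s i \<subseteq> up_edges N"
  by (auto simp: mono_edges_def)

lemma up_edge_mono_edges_subset:
  assumes roles: "u \<in> verts H" "v \<in> verts H"
  shows "up_edge ` mono_edges H u v X \<kappa> N s i \<subseteq> {e \<in> edges (hypercube N). e \<subseteq> mono_verts \<kappa> N s i}"
proof clarify
  fix j \<epsilon> assume mem: "(j, \<epsilon>) \<in> mono_edges H u v X \<kappa> N s i"
  then have up: "(j, \<epsilon>) \<in> up_edges N" by (rule subsetD[OF mono_edges_subset])
  obtain g where g: "(g u, g v) = s j" "\<And>w. w \<in> verts H \<Longrightarrow> \<kappa> ((subcube N s \<epsilon>)(j := g w)) = i"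
    using mem by (auto simp: mono_edges_def mono_line_copy_def)
  then have "fst (s j) = g u" "snd (s j) = g v" by (metis fst_conv, metis snd_conv)
  then have "\<kappa> (subcube N s \<epsilon>) = i" "\<kappa> (subcube N s (\<epsilon>(j := 1))) = i"
    using g(2) roles subcube_down[OF up, of s] subcube_up[OF up, of s] by metis+
  then show "up_edge (j, \<epsilon>) \<in> edges (hypercube N) \<and> up_edge (j, \<epsilon>) \<subseteq> mono_verts \<kappa> N s i"
    using up_edge_mem_edges_hypercube[OF up] up_edges_cube_verts[OF up]
    by (auto simp: up_edge_def mono_verts_def)
qed

lemma exists_popular_class:
  fixes r :: nat
  assumes fin: "finite E" and "0 < r" and cover: "\<And>e. e \<in> E \<Longrightarrow> \<exists>i<r. e \<in> M i"
  shows "\<exists>i<r. card E \<le> r * card (E \<inter> M i)"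
proof -
  obtain colour where colour: "\<And>e. e \<in> E \<Longrightarrow> colour e < r \<and> e \<in> M (colour e)"
    using cover by metis
  then have "colour \<in> E \<rightarrow> {..<r}" by blast
  then obtain i where "i < r" "card E \<le> card (colour -` {i} \<inter> E) * r"
    using pigeonhole_card[of colour E "{..<r}"] assms(1,2) by auto
  moreover have "card (colour -` {i} \<inter> E) \<le> card (E \<inter> M i)"
    using fin colour by (intro card_mono) auto
  ultimately have "card E \<le> r * card (E \<inter> M i)" by (metis le_trans mult.commute mult_le_mono2)
  then show ?thesis using \<open>i < r\<close> by blast
qed

lemma exists_dense_mono_edges:
  fixes X :: "'a::real_normed_vector set"
  assumes "finite X" and arrows: "arrows False X H r" and roles: "u \<in> verts H" "v \<in> verts H"
    and colouring: "\<kappa> \<in> UNIV \<rightarrow> {..<r}"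
  shows "\<exists>s\<in>grid N (role_pairs H u v X). \<exists>i.
    card (up_edges N) \<le> card (role_pairs H u v X) * r * card (mono_edges H u v X \<kappa> N s i)"
proof -
  define P where "P = role_pairs H u v X"
  define Good where "Good j x y \<longleftrightarrow>
    (\<exists>g i. i < r \<and> mono_line_copy False H X \<kappa> i j x g \<and> g u = x j \<and> g v = y j)" for j x y
  have copy: "\<exists>g i. i < r \<and> mono_line_copy False H X \<kappa> i j z g \<and> (g u, g v) \<in> P" for j z
    using exists_mono_line_copy[OF arrows _ colouring, of j z] roles(1)
    unfolding P_def role_pairs_def mono_line_copy_def by blast
  have P_bounds: "P \<noteq> {}" "P \<subseteq> X \<times> X" using copy role_pairs_subset[OF roles] by (auto simp: P_def)
  then have "finite P" using \<open>finite X\<close> by (meson finite_SigmaI finite_subset)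
  have "\<exists>(p, q)\<in>P. Good j (z(j := p)) (z(j := q))" for j z
    using copy[of j z] unfolding Good_def by fastforce
  then obtain s where s_grid: "s \<in> grid N P" and dense: "card (up_edges N) \<le>
      card P * card {(j, \<epsilon>) \<in> up_edges N. Good j (subcube N s (\<epsilon>(j := 1))) (subcube N s \<epsilon>)}"
      (is "_ \<le> _ * card ?good")
    using exists_dense_subcube[OF \<open>finite P\<close> P_bounds, of N Good] by blast
  have "\<exists>i<r. (j, \<epsilon>) \<in> mono_edges H u v X \<kappa> N s i"
    if up: "(j, \<epsilon>) \<in> up_edges N" and "Good j (subcube N s (\<epsilon>(j := 1))) (subcube N s \<epsilon>)" for j \<epsilon>
    using that fun_cong[OF subcube_down[OF up, of s], of j]
    by (auto simp: Good_def mono_edges_def subcube_up[OF up] prod_eq_iff simp del: One_nat_def)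
  moreover have "finite ?good" by (rule finite_subset[OF _ finite_up_edges]) auto
  moreover have "0 < r" using colouring by fastforce
  ultimately obtain i where "card ?good \<le> r * card (?good \<inter> mono_edges H u v X \<kappa> N s i)"
    using exists_popular_class[of ?good r "mono_edges H u v X \<kappa> N s"] by auto
  also have "card (?good \<inter> mono_edges H u v X \<kappa> N s i) \<le> card (mono_edges H u v X \<kappa> N s i)"
    by (intro card_mono finite_subset[OF mono_edges_subset finite_up_edges]) auto
  finally have popular: "card ?good \<le> r * card (mono_edges H u v X \<kappa> N s i)" by simp
  have "card (up_edges N) \<le> card P * (r * card (mono_edges H u v X \<kappa> N s i))"
    using dense by (rule order_trans) (rule mult_le_mono2[OF popular])
  then show ?thesis using s_grid unfolding P_def by (auto simp: mult.assoc)
qed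

lemma zero_avoidance_density_mono_edges:
  fixes c :: "'a::euclidean_space \<Rightarrow> nat"
  assumes dim: "2 \<le> DIM('a)" and density: "zero_avoidance_density Q"
    and fin: "finite (verts H)" and roles: "u \<in> verts H" "v \<in> verts H"
    and arrows: "arrows False (UNIV :: 'a set) H r" and colouring: "c \<in> UNIV \<rightarrow> {..<r}"
  shows "\<exists>N X \<phi> s i. generic_grid_map N X \<phi> \<and> s \<in> grid N (role_pairs H u v X) \<and>
    (\<forall>G. subgraph G (hypercube N) \<longrightarrow>
      up_edge ` mono_edges H u v X (c \<circ> \<phi>) N s i \<subseteq> edges G \<longrightarrow> Q N G)"
proof -
  obtain X :: "'a set" where X: "finite X" "arrows False X H r"
    using arrows_finite_subset[OF fin arrows] by blast
  have "role_pairs H u v X \<noteq> {}"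
    using X(2) colouring unfolding arrows_def role_pairs_def by (auto simp: Pi_iff)
  moreover have "finite (role_pairs H u v X)"
    by (rule finite_subset[OF role_pairs_subset[OF roles]]) (simp add: X(1))
  moreover have "0 < r" using colouring by fastforce
  ultimately have "0 < card (role_pairs H u v X) * r" by (simp add: card_gt_0_iff)
  then obtain N where unavoidable: "\<And>G. \<lbrakk>subgraph G (hypercube N);
      card (edges (hypercube N)) \<le> card (role_pairs H u v X) * r * card (edges G)\<rbrakk> \<Longrightarrow> Q N G"
    using zero_avoidance_density_dense_cube[OF density] by blast
  obtain \<phi> where generic: "generic_grid_map N X \<phi>"
    using exists_generic_grid_map[OF dim X(1)] by blast
  have "c \<circ> \<phi> \<in> UNIV \<rightarrow> {..<r}" using colouring by auto
  then obtain s i where s_grid: "s \<in> grid N (role_pairs H u v X)"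
    and dense: "card (up_edges N) \<le>
      card (role_pairs H u v X) * r * card (mono_edges H u v X (c \<circ> \<phi>) N s i)"
    using exists_dense_mono_edges[OF X roles] by blast
  have "Q N G" if G: "subgraph G (hypercube N)"
    and sub: "up_edge ` mono_edges H u v X (c \<circ> \<phi>) N s i \<subseteq> edges G" for G
  proof (rule unavoidable[OF G])
    have "finite (edges G)"
      using G finite_subset[OF _ finite_edges_hypercube] by (auto simp: subgraph_def)
    then have "card (mono_edges H u v X (c \<circ> \<phi>) N s i) \<le> card (edges G)"
      using inj_on_subset[OF inj_on_up_edge mono_edges_subset] sub by (intro card_inj_on_le)
    then show "card (edges (hypercube N)) \<le> card (role_pairs H u v X) * r * card (edges G)"
      using dense unfolding card_edges_hypercube by (meson le_trans mult_le_mono2)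
  qed
  then show ?thesis using generic s_grid by blast
qed

lemma arrows_if_zero_density:
  fixes H :: "'v graph"
  assumes dim: "2 \<le> DIM('a::euclidean_space)" and density: "zero_avoidance_density Q"
    and copy: "\<And>N G. Q N G \<Longrightarrow> \<exists>f. graph_embedding ind f H G"
    and edge: "arrows False (UNIV :: 'a set) single_edge r"
  shows "arrows ind (UNIV :: 'a set) H r"
  unfolding arrows_def
proof
  fix c :: "'a \<Rightarrow> nat" assume colouring: "c \<in> UNIV \<rightarrow> {..<r}"
  have "finite (verts single_edge)" "True \<in> verts single_edge" "False \<in> verts single_edge"
    by simp_all
  then obtain N X and \<phi> :: "(nat \<Rightarrow> 'a) \<Rightarrow> 'a" and s i where generic: "generic_grid_map N X \<phi>"
    and s_grid: "s \<in> grid N (role_pairs single_edge True False X)"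
    and unavoidable: "\<And>G. \<lbrakk>subgraph G (hypercube N);
        up_edge ` mono_edges single_edge True False X (c \<circ> \<phi>) N s i \<subseteq> edges G\<rbrakk> \<Longrightarrow> Q N G"
    using zero_avoidance_density_mono_edges[OF dim density _ _ _ edge colouring, of True False]
    by blast
  define \<theta> where "\<theta> = \<phi> \<circ> subcube N s"
  define W where "W = mono_verts (c \<circ> \<phi>) N s i"
  define G where "G = (W, {e \<in> edges (hypercube N). e \<subseteq> W})"
  have W: "W \<subseteq> cube_verts N" "\<And>\<epsilon>. \<epsilon> \<in> W \<Longrightarrow> c (\<theta> \<epsilon>) = i" by (auto simp: W_def mono_verts_def \<theta>_def)
  have "up_edge ` mono_edges single_edge True False X (c \<circ> \<phi>) N s i \<subseteq> edges G"
    using up_edge_mono_edges_subset[of True single_edge False]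
    unfolding G_def W_def snd_conv by simp
  moreover have "subgraph G (hypercube N)"
    using W(1) by (auto simp: G_def subgraph_def hypercube_def)
  ultimately obtain f :: "'v \<Rightarrow> nat \<Rightarrow> nat" where emb: "graph_embedding ind f H G"
    using copy[OF unavoidable] by blast
  have "graph_embedding True id G (hypercube N)"
    using W(1) by (auto simp: G_def graph_embedding_def hypercube_def)
  moreover have "unit_embedding True (hypercube N) \<theta>"
    unfolding \<theta>_def
    by (rule unit_embedding_subcube[OF generic s_grid[unfolded role_pairs_single_edge]])
  ultimately have "unit_embedding True G (\<theta> \<circ> id)" by (rule unit_embedding_comp)
  then have "unit_embedding ind G \<theta>" by (auto simp: unit_embedding_def)
  from unit_embedding_comp[OF emb this] have "unit_embedding ind H (\<theta> \<circ> f)" .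
  moreover have "monochromatic c ((\<theta> \<circ> f) ` verts H)"
    using graph_embedding_image[OF emb] W(2) unfolding monochromatic_def
    by (intro exI[of _ i]) (auto simp: G_def)
  ultimately show "\<exists>g. unit_embedding ind H g \<and> g ` verts H \<subseteq> UNIV \<and> monochromatic c (g ` verts H)"
    by blast
qed

lemma arrows_zero_density_iff:
  fixes H :: "'v graph"
  assumes dim: "2 \<le> DIM('a::euclidean_space)" and graph: "simple_graph H" "edges H \<noteq> {}"
    and density: "zero_avoidance_density Q" "\<And>N G. Q N G \<Longrightarrow> \<exists>f. graph_embedding ind f H G"
  shows "arrows ind (UNIV :: 'a set) H r \<longleftrightarrow> arrows False (UNIV :: 'a set) single_edge r"
proof
  assume "arrows ind (UNIV :: 'a set) H r"
  then show "arrows False (UNIV :: 'a set) single_edge r"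
    using single_edge_embedding[OF graph] arrows_if_embedding arrows_weaken_induced by blast
qed (rule arrows_if_zero_density[OF dim density])

section \<open>Edge replacements\<close>

definition replaced_edges :: "'g graph \<Rightarrow> 'g set \<Rightarrow> 'g set \<Rightarrow> ('g \<times> 'g) set" where
  "replaced_edges \<Gamma> A B = {(a, b). a \<in> A \<and> b \<in> B \<and> {a, b} \<in> edges \<Gamma>}"

definition glue :: "('g \<Rightarrow> 'x) \<Rightarrow> ('g \<Rightarrow> 'g \<Rightarrow> 'v \<Rightarrow> 'x) \<Rightarrow> 'g + ('g \<times> 'g) \<times> 'v \<Rightarrow> 'x" where
  "glue h e = case_sum h (\<lambda>((a, b), w). e a b w)"

lemma
  shows verts_edge_replacement: "verts (edge_replacement \<Gamma> A B H u v) =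
      Inl ` verts \<Gamma> \<union> (\<Union>(a, b)\<in>replaced_edges \<Gamma> A B. role u v a b ` verts H)"
    and edges_edge_replacement: "edges (edge_replacement \<Gamma> A B H u v) =
      (\<Union>(a, b)\<in>replaced_edges \<Gamma> A B. (\<lambda>e. role u v a b ` e) ` edges H)"
  by (simp_all add: edge_replacement_def replaced_edges_def Let_def)

lemma replaced_edges_verts:
  assumes "bipartite_with_parts \<Gamma> A B" "(a, b) \<in> replaced_edges \<Gamma> A B"
  shows "a \<in> verts \<Gamma>" "b \<in> verts \<Gamma>"
  using assms by (auto simp: bipartite_with_parts_def replaced_edges_def)

lemma replaced_edges_nonempty:
  assumes bip: "bipartite_with_parts \<Gamma> A B" and "edges \<Gamma> \<noteq> {}"
  obtains a b where "(a, b) \<in> replaced_edges \<Gamma> A B" "a \<noteq> b"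
proof -
  obtain e where "e \<in> edges \<Gamma>" using assms(2) by blast
  then obtain a b where "a \<in> A" "b \<in> B" "{a, b} \<in> edges \<Gamma>"
    using bip unfolding bipartite_with_parts_def by metis
  moreover have "A \<inter> B = {}" using bip by (simp add: bipartite_with_parts_def)
  ultimately show thesis using that by (auto simp: replaced_edges_def)
qed

lemma edge_replacement_vertexE:
  assumes "bipartite_with_parts \<Gamma> A B" and "x \<in> verts (edge_replacement \<Gamma> A B H u v)"
  obtains (old) \<gamma> where "x = Inl \<gamma>" "\<gamma> \<in> verts \<Gamma>"
    | (new) a b w where "x = Inr ((a, b), w)" "(a, b) \<in> replaced_edges \<Gamma> A B" "w \<in> verts H - {u, v}"
  using assms replaced_edges_verts[OF assms(1)] unfolding verts_edge_replacement
  by (auto simp: role_def split: if_splits)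

lemma role_embedding:
  assumes "(a, b) \<in> replaced_edges \<Gamma> A B" "a \<noteq> b" "u \<noteq> v"
  shows "graph_embedding False (role u v a b) H (edge_replacement \<Gamma> A B H u v)"
proof -
  have "role u v a b ` e \<in> edges (edge_replacement \<Gamma> A B H u v)" if "e \<in> edges H" for e
    using assms(1) that unfolding edges_edge_replacement by blast
  from this[of "{_, _}"]
  have "{role u v a b x, role u v a b y} \<in> edges (edge_replacement \<Gamma> A B H u v)"
    if "{x, y} \<in> edges H" for x y using that by simp
  moreover have "role u v a b ` verts H \<subseteq> verts (edge_replacement \<Gamma> A B H u v)"
    using assms(1) unfolding verts_edge_replacement by blast
  moreover have "inj_on (role u v a b) (verts H)"
    using assms(2,3) by (auto simp: inj_on_def role_def)
  ultimately show ?thesis by (simp add: graph_embedding_def)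
qed

lemma glue_role: "e a b u = h a \<Longrightarrow> e a b v = h b \<Longrightarrow> glue h e (role u v a b w) = e a b w"
  by (simp add: glue_def role_def)

lemma inj_on_glue:
  assumes bip: "bipartite_with_parts \<Gamma> A B" and inj_h: "inj_on h (verts \<Gamma>)"
    and inj_e: "\<And>a b. (a, b) \<in> replaced_edges \<Gamma> A B \<Longrightarrow> inj_on (e a b) (verts H)"
    and fresh: "\<And>a b w. \<lbrakk>(a, b) \<in> replaced_edges \<Gamma> A B; w \<in> verts H - {u, v}\<rbrakk> \<Longrightarrow>
      e a b w \<notin> h ` verts \<Gamma>"
    and sep: "\<And>a b w a' b' w'. \<lbrakk>(a, b) \<in> replaced_edges \<Gamma> A B; (a', b') \<in> replaced_edges \<Gamma> A B;
      w \<in> verts H - {u, v}; w' \<in> verts H - {u, v}; e a b w = e a' b' w'\<rbrakk> \<Longrightarrow> a = a' \<and> b = b'"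
  shows "inj_on (glue h e) (verts (edge_replacement \<Gamma> A B H u v))"
proof (rule inj_onI)
  fix x y
  assume x: "x \<in> verts (edge_replacement \<Gamma> A B H u v)"
    and y: "y \<in> verts (edge_replacement \<Gamma> A B H u v)" and same_image: "glue h e x = glue h e y"
  from bip x show "x = y"
  proof (cases rule: edge_replacement_vertexE)
    case x_old: (old \<gamma>)
    from bip y show ?thesis
    proof (cases rule: edge_replacement_vertexE)
      case (old \<gamma>')
      then show ?thesis using x_old same_image inj_onD[OF inj_h] by (simp add: glue_def)
    next
      case (new a b w)
      then have "e a b w = h \<gamma>" using x_old same_image by (simp add: glue_def)
      then show ?thesis using fresh[OF new(2,3)] x_old(2) by blast
    qed
  next
    case x_new: (new a b w)
    from bip y show ?thesis
    proof (cases rule: edge_replacement_vertexE)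
      case (old \<gamma>)
      then have "e a b w = h \<gamma>" using x_new same_image by (simp add: glue_def)
      then show ?thesis using fresh[OF x_new(2,3)] old(2) by blast
    next
      case (new a' b' w')
      then have e_eq: "e a b w = e a' b' w'" using x_new same_image by (simp add: glue_def)
      then have "a = a'" "b = b'" using sep x_new new by blast+
      then show ?thesis using inj_onD[OF inj_e[OF x_new(2)]] e_eq x_new new by auto
    qed
  qed
qed

lemma unit_embedding_glue:
  assumes simple: "simple_graph H"
    and inj: "inj_on (glue h e) (verts (edge_replacement \<Gamma> A B H u v))"
    and copy: "\<And>a b. (a, b) \<in> replaced_edges \<Gamma> A B \<Longrightarrow>
      unit_embedding False H (e a b) \<and> e a b u = h a \<and> e a b v = h b"
  shows "unit_embedding False (edge_replacement \<Gamma> A B H u v) (glue h e)"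
proof -
  have "norm (glue h e x - glue h e y) = 1"
    if edge: "{x, y} \<in> edges (edge_replacement \<Gamma> A B H u v)" for x y
  proof -
    obtain a b d where ab: "(a, b) \<in> replaced_edges \<Gamma> A B" and d: "d \<in> edges H"
      and xy: "{x, y} = role u v a b ` d"
      using edge unfolding edges_edge_replacement by auto
    obtain p q where pq: "d = {p, q}" "p \<in> verts H" "q \<in> verts H"
      using simple_graph_edgeE[OF simple d] by metis
    have "norm (e a b p - e a b q) = 1" using unit_embedding_edge pq d copy[OF ab] by metis
    then have "norm (glue h e (role u v a b p) - glue h e (role u v a b q)) = 1"
      using copy[OF ab] by (simp add: glue_role)
    moreover have "{x, y} = {role u v a b p, role u v a b q}" using xy pq(1) by simp
    ultimately show ?thesis by (auto simp: doubleton_eq_iff norm_minus_commute)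
  qed
  then show ?thesis using inj by (simp add: unit_embedding_def)
qed

lemma contains_layered_copy_up_edges:
  assumes copy: "contains_layered_copy N (W, up_edge ` E) \<Gamma> A B" and up_edges: "E \<subseteq> up_edges N"
  obtains f J where "inj_on f (verts \<Gamma>)" "f ` verts \<Gamma> \<subseteq> W"
    "\<And>a b. (a, b) \<in> replaced_edges \<Gamma> A B \<Longrightarrow> (J a b, f b) \<in> E \<and> f a = (f b)(J a b := 1)"
proof -
  obtain K f k where K: "subgraph K (W, up_edge ` E)" and iso: "graph_iso f \<Gamma> K"
    and k: "1 \<le> k" and layers: "f ` A \<subseteq> layer N k" "f ` B \<subseteq> layer N (k - 1)"
    using copy unfolding contains_layered_copy_def by blast
  have "\<exists>j. (j, f b) \<in> E \<and> f a = (f b)(j := 1)" if ab: "(a, b) \<in> replaced_edges \<Gamma> A B" for a b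
  proof -
    have "f ` {a, b} \<in> edges K"
      using iso ab unfolding graph_iso_def replaced_edges_def by blast
    then obtain j \<epsilon> where mem: "(j, \<epsilon>) \<in> E" and "{f a, f b} = up_edge (j, \<epsilon>)"
      using K by (auto simp: subgraph_def)
    moreover have "f a \<in> layer N (Suc (k - 1))" "f b \<in> layer N (k - 1)"
      using layers k ab by (auto simp: replaced_edges_def)
    ultimately have "f b = \<epsilon>" "f a = \<epsilon>(j := 1)"
      using up_edge_between_layers[OF subsetD[OF up_edges mem]] by blast+
    then show ?thesis using mem by blast
  qed
  then obtain J where
    "\<And>a b. (a, b) \<in> replaced_edges \<Gamma> A B \<Longrightarrow> (J a b, f b) \<in> E \<and> f a = (f b)(J a b := 1)"
    by metis
  moreover have "inj_on f (verts \<Gamma>)" "f ` verts \<Gamma> \<subseteq> W"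
    using iso K by (auto simp: graph_iso_def bij_betw_def subgraph_def)
  ultimately show thesis using that by blast
qed

locale line_copies =
  fixes H :: "'v graph" and u v :: 'v and \<Gamma> :: "'g graph" and A B :: "'g set"
    and N :: nat and X :: "'a::real_normed_vector set" and \<kappa> :: "(nat \<Rightarrow> 'a) \<Rightarrow> nat"
    and s :: "nat \<Rightarrow> 'a \<times> 'a" and i :: nat
    and f :: "'g \<Rightarrow> nat \<Rightarrow> nat" and J :: "'g \<Rightarrow> 'g \<Rightarrow> nat" and g :: "'g \<Rightarrow> 'g \<Rightarrow> 'v \<Rightarrow> 'a"
  assumes roles: "u \<in> verts H" "v \<in> verts H" "u \<noteq> v"
    and bip: "bipartite_with_parts \<Gamma> A B"
    and s_grid: "s \<in> grid N (role_pairs H u v X)"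
    and f_inj: "inj_on f (verts \<Gamma>)"
    and f_mono: "f ` verts \<Gamma> \<subseteq> mono_verts \<kappa> N s i"
    and up: "(a, b) \<in> replaced_edges \<Gamma> A B \<Longrightarrow> (J a b, f b) \<in> up_edges N"
    and f_up: "(a, b) \<in> replaced_edges \<Gamma> A B \<Longrightarrow> f a = (f b)(J a b := 1)"
    and g_copy: "(a, b) \<in> replaced_edges \<Gamma> A B \<Longrightarrow>
      mono_line_copy False H X \<kappa> i (J a b) (subcube N s (f b)) (g a b)"
    and g_ends: "(a, b) \<in> replaced_edges \<Gamma> A B \<Longrightarrow> s (J a b) = (g a b u, g a b v)"
begin

definition vertex :: "'g \<Rightarrow> nat \<Rightarrow> 'a" where
  "vertex \<gamma> = subcube N s (f \<gamma>)"

definition line_copy :: "'g \<Rightarrow> 'g \<Rightarrow> 'v \<Rightarrow> nat \<Rightarrow> 'a" where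
  "line_copy a b w = (subcube N s (f b))(J a b := g a b w)"

lemma s_distinct: "j < N \<Longrightarrow> fst (s j) \<noteq> snd (s j)"
  using role_pairs_distinct[OF _ roles] grid_mem[OF s_grid] by (metis prod.collapse)

lemma inj_on_g: "(a, b) \<in> replaced_edges \<Gamma> A B \<Longrightarrow> inj_on (g a b) (verts H)"
  using g_copy unfolding mono_line_copy_def by (blast dest: unit_embedding_inj_on)

lemma line_copy_ends:
  assumes "(a, b) \<in> replaced_edges \<Gamma> A B"
  shows "line_copy a b u = vertex a" "line_copy a b v = vertex b"
  using subcube_up[OF up[OF assms], of s] subcube_down[OF up[OF assms], of s]
  by (simp_all add: line_copy_def vertex_def g_ends[OF assms] f_up[OF assms])

lemma interior_off_pair:
  assumes "(a, b) \<in> replaced_edges \<Gamma> A B" "w \<in> verts H - {u, v}"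
  shows "g a b w \<notin> {fst (s (J a b)), snd (s (J a b))}"
  using inj_on_g[OF assms(1)] g_ends[OF assms(1)] roles assms(2) by (auto dest: inj_onD)

lemma inj_on_vertex: "inj_on vertex (verts \<Gamma>)"
proof -
  have "inj_on (subcube N s) (f ` verts \<Gamma>)"
    using f_mono
    by (intro inj_on_subset[OF inj_on_subcube[OF s_distinct]]) (auto simp: mono_verts_def)
  from comp_inj_on[OF f_inj this] show ?thesis by (simp add: vertex_def[abs_def] comp_def)
qed

lemma line_copy_interior_disjoint:
  assumes ab: "(a, b) \<in> replaced_edges \<Gamma> A B" and ab': "(a', b') \<in> replaced_edges \<Gamma> A B"
    and w: "w \<in> verts H - {u, v}" and w': "w' \<in> verts H - {u, v}"
    and common: "line_copy a b w = line_copy a' b' w'"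
  shows "a = a' \<and> b = b'"
proof -
  have same: "J a b = J a' b' \<and> f b = f b'"
    by (rule up_edge_eq_if_common_point[OF up[OF ab] up[OF ab'] s_distinct
          interior_off_pair[OF ab w] interior_off_pair[OF ab' w'] common[unfolded line_copy_def]])
  then have "f a = f a'" using f_up[OF ab] f_up[OF ab'] by simp
  with same show ?thesis
    using inj_onD[OF f_inj] replaced_edges_verts[OF bip ab] replaced_edges_verts[OF bip ab']
    by blast
qed

definition placement :: "'g + ('g \<times> 'g) \<times> 'v \<Rightarrow> nat \<Rightarrow> 'a" where
  "placement = glue vertex line_copy"

lemma inj_on_placement: "inj_on placement (verts (edge_replacement \<Gamma> A B H u v))"
  unfolding placement_def
proof (rule inj_on_glue[OF bip inj_on_vertex _ _ line_copy_interior_disjoint])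
  show "inj_on (line_copy a b) (verts H)" if "(a, b) \<in> replaced_edges \<Gamma> A B" for a b
    using inj_on_g[OF that] unfolding inj_on_def line_copy_def by (metis fun_upd_same)
  show "line_copy a b w \<notin> vertex ` verts \<Gamma>"
    if ab: "(a, b) \<in> replaced_edges \<Gamma> A B" and w: "w \<in> verts H - {u, v}" for a b w
    using off_subcube[of _ N _ s, OF up_edges_coord(1)[OF up[OF ab]] interior_off_pair[OF ab w]]
    by (auto simp: line_copy_def vertex_def)
qed

lemma placement_mono:
  assumes "x \<in> verts (edge_replacement \<Gamma> A B H u v)"
  shows "placement x \<in> grid N X \<and> \<kappa> (placement x) = i"
  using bip assms
proof (cases rule: edge_replacement_vertexE)
  case (old \<gamma>)
  then show ?thesis using f_mono subcube_in_grid[OF s_grid role_pairs_subset[OF roles(1,2)]]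
    by (auto simp: placement_def glue_def vertex_def mono_verts_def)
next
  case (new a b w)
  then show ?thesis
    using g_copy[OF new(2)] up_edges_coord(1)[OF up[OF new(2)]]
      subcube_in_grid[OF s_grid role_pairs_subset[OF roles(1,2)]]
    by (auto simp: placement_def glue_def line_copy_def mono_line_copy_def intro!: grid_upd)
qed

lemma unit_embedding_placement:
  assumes generic: "generic_grid_map N X \<phi>" and simple: "simple_graph H"
  shows "unit_embedding False (edge_replacement \<Gamma> A B H u v) (\<phi> \<circ> placement)"
proof -
  have comp: "\<phi> \<circ> placement = glue (\<phi> \<circ> vertex) (\<lambda>a b. \<phi> \<circ> line_copy a b)"
    by (auto simp: placement_def glue_def fun_eq_iff split: sum.splits)
  have "inj_on (\<phi> \<circ> placement) (verts (edge_replacement \<Gamma> A B H u v))"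
    using placement_mono
    by (intro comp_inj_on inj_on_placement
        inj_on_subset[OF generic_grid_map_inj_on[OF generic]]) auto
  moreover have "unit_embedding False H (\<phi> \<circ> line_copy a b)"
    if ab: "(a, b) \<in> replaced_edges \<Gamma> A B" for a b
    using unit_embedding_line[OF generic up_edges_coord(1)[OF up[OF ab]], of False H "g a b"]
      g_copy[OF ab]
    by (simp add: mono_line_copy_def line_copy_def comp_def)
  ultimately show ?thesis
    unfolding comp by (intro unit_embedding_glue[OF simple]) (simp_all add: line_copy_ends)
qed

end

lemma layered_copy_line_copies:
  assumes roles: "u \<in> verts H" "v \<in> verts H" "u \<noteq> v" and bip: "bipartite_with_parts \<Gamma> A B"
    and s_grid: "s \<in> grid N (role_pairs H u v X)"
    and layered: "contains_layered_copy N
      (mono_verts \<kappa> N s i, up_edge ` mono_edges H u v X \<kappa> N s i) \<Gamma> A B"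
  shows "\<exists>f J g. line_copies H u v \<Gamma> A B N X \<kappa> s i f J g"
proof -
  obtain f J where f: "inj_on f (verts \<Gamma>)" "f ` verts \<Gamma> \<subseteq> mono_verts \<kappa> N s i"
    and J: "\<And>a b. (a, b) \<in> replaced_edges \<Gamma> A B \<Longrightarrow>
      (J a b, f b) \<in> mono_edges H u v X \<kappa> N s i \<and> f a = (f b)(J a b := 1)"
    using contains_layered_copy_up_edges[OF layered mono_edges_subset] by blast
  have "\<exists>g. mono_line_copy False H X \<kappa> i (J a b) (subcube N s (f b)) g \<and> (g u, g v) = s (J a b)"
    if "(a, b) \<in> replaced_edges \<Gamma> A B" for a b using J[OF that] by (auto simp: mono_edges_def)
  then obtain g where g: "\<And>a b. (a, b) \<in> replaced_edges \<Gamma> A B \<Longrightarrow>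
      mono_line_copy False H X \<kappa> i (J a b) (subcube N s (f b)) (g a b) \<and>
      s (J a b) = (g a b u, g a b v)"
    by metis
  have "line_copies H u v \<Gamma> A B N X \<kappa> s i f J g"
  proof
    show "(J a b, f b) \<in> up_edges N" if "(a, b) \<in> replaced_edges \<Gamma> A B" for a b
      by (rule subsetD[OF mono_edges_subset]) (use J[OF that] in blast)
  qed (use roles bip s_grid f J g in auto)
  then show ?thesis by blast
qed

lemma arrows_edge_replacement:
  fixes H :: "'v graph" and \<Gamma> :: "'g graph"
  assumes dim: "2 \<le> DIM('a::euclidean_space)" and simple: "simple_graph H"
    and roles: "u \<in> verts H" "v \<in> verts H" "u \<noteq> v"
    and bip: "bipartite_with_parts \<Gamma> A B" and density: "zero_strong_cube_density \<Gamma> A B"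
    and arrows: "arrows False (UNIV :: 'a set) H r"
  shows "arrows False (UNIV :: 'a set) (edge_replacement \<Gamma> A B H u v) r"
  unfolding arrows_def
proof
  fix c :: "'a \<Rightarrow> nat" assume colouring: "c \<in> UNIV \<rightarrow> {..<r}"
  have "finite (verts H)" using simple by (simp add: simple_graph_def)
  then obtain N X and \<phi> :: "(nat \<Rightarrow> 'a) \<Rightarrow> 'a" and s i where generic: "generic_grid_map N X \<phi>"
    and s_grid: "s \<in> grid N (role_pairs H u v X)"
    and copy: "\<And>G. \<lbrakk>subgraph G (hypercube N);
        up_edge ` mono_edges H u v X (c \<circ> \<phi>) N s i \<subseteq> edges G\<rbrakk> \<Longrightarrow> contains_layered_copy N G \<Gamma> A B"
    using zero_avoidance_density_mono_edges[OF dim zero_strong_cube_density_imp[OF density]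
        _ roles(1,2) arrows colouring] by blast
  let ?G = "(mono_verts (c \<circ> \<phi>) N s i, up_edge ` mono_edges H u v X (c \<circ> \<phi>) N s i)"
  have "subgraph ?G (hypercube N)"
    using up_edge_mono_edges_subset[OF roles(1,2), of X "c \<circ> \<phi>" N s i]
    by (auto simp: subgraph_def mono_verts_def hypercube_def)
  then have "contains_layered_copy N ?G \<Gamma> A B" using copy by simp
  then obtain f J g where "line_copies H u v \<Gamma> A B N X (c \<circ> \<phi>) s i f J g"
    using layered_copy_line_copies[OF roles bip s_grid] by blast
  then interpret line_copies H u v \<Gamma> A B N X "c \<circ> \<phi>" s i f J g .
  have "monochromatic c ((\<phi> \<circ> placement) ` verts (edge_replacement \<Gamma> A B H u v))"
    using placement_mono by (auto simp: monochromatic_def)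
  then show "\<exists>t. unit_embedding False (edge_replacement \<Gamma> A B H u v) t \<and>
      t ` verts (edge_replacement \<Gamma> A B H u v) \<subseteq> UNIV \<and>
      monochromatic c (t ` verts (edge_replacement \<Gamma> A B H u v))"
    using unit_embedding_placement[OF generic simple] by blast
qed

lemma arrows_edge_replacement_iff:
  fixes H :: "'v graph" and \<Gamma> :: "'g graph"
  assumes dim: "2 \<le> DIM('a::euclidean_space)" and simple: "simple_graph H"
    and roles: "u \<in> verts H" "v \<in> verts H" "u \<noteq> v"
    and pattern: "edges \<Gamma> \<noteq> {}" "bipartite_with_parts \<Gamma> A B" "zero_strong_cube_density \<Gamma> A B"
  shows "arrows False (UNIV :: 'a set) (edge_replacement \<Gamma> A B H u v) r \<longleftrightarrow>
    arrows False (UNIV :: 'a set) H r"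
proof
  obtain a b where "(a, b) \<in> replaced_edges \<Gamma> A B" "a \<noteq> b"
    by (rule replaced_edges_nonempty[OF pattern(2,1)])
  then have "graph_embedding False (role u v a b) H (edge_replacement \<Gamma> A B H u v)"
    by (rule role_embedding[OF _ _ roles(3)])
  moreover assume "arrows False (UNIV :: 'a set) (edge_replacement \<Gamma> A B H u v) r"
  ultimately show "arrows False (UNIV :: 'a set) H r" by (rule arrows_if_embedding)
qed (rule arrows_edge_replacement[OF dim simple roles pattern(2,3)])

section \<open>Rich monochromatic sets\<close>

lemma exists_min_degree_subset:
  assumes "finite V" "finite L" "\<And>l. l \<in> L \<Longrightarrow> S l \<subseteq> V \<and> S l \<noteq> {}" "d * card V < card L"
  shows "\<exists>W\<subseteq>V. W \<noteq> {} \<and> (\<forall>w\<in>W. d \<le> card {l\<in>L. w \<in> S l \<and> S l \<subseteq> W})"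
  using assms
proof (induction "card V" arbitrary: V L rule: less_induct)
  case less
  show ?case
  proof (cases "\<forall>w\<in>V. d \<le> card {l\<in>L. w \<in> S l}")
    case True
    have "L \<noteq> {}" using less.prems(4) by auto
    then have "V \<noteq> {}" using less.prems(3) by blast
    moreover have "{l\<in>L. w \<in> S l \<and> S l \<subseteq> V} = {l\<in>L. w \<in> S l}" for w
      using less.prems(3) by blast
    ultimately show ?thesis using True by (intro exI[of _ V]) auto
  next
    case False
    then obtain w where w: "w \<in> V" "card {l\<in>L. w \<in> S l} < d" by (auto simp: not_le)
    define L' where "L' = {l\<in>L. w \<notin> S l}"
    have L': "finite L'" "\<And>l. l \<in> L' \<Longrightarrow> S l \<subseteq> V - {w} \<and> S l \<noteq> {}"
      using less.prems by (auto simp: L'_def)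
    have "L = L' \<union> {l\<in>L. w \<in> S l}" "L' \<inter> {l\<in>L. w \<in> S l} = {}" by (auto simp: L'_def)
    then have "card L = card L' + card {l\<in>L. w \<in> S l}"
      using less.prems(2) by (metis (lifting) card_Un_disjoint finite_Un)
    moreover have card_V: "card V = Suc (card (V - {w}))"
      using w less.prems(1) by (metis card.remove)
    ultimately have "d * card (V - {w}) < card L'" using less.prems(4) w(2) by simp
    then obtain W where W: "W \<subseteq> V - {w}" "W \<noteq> {}"
      "\<forall>x\<in>W. d \<le> card {l\<in>L'. x \<in> S l \<and> S l \<subseteq> W}"
      using less.hyps[of "V - {w}" L'] card_V L' less.prems(1) by auto
    have "card {l\<in>L'. x \<in> S l \<and> S l \<subseteq> W} \<le> card {l\<in>L. x \<in> S l \<and> S l \<subseteq> W}" for x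
      using less.prems(2) by (intro card_mono) (auto simp: L'_def)
    then have "\<forall>x\<in>W. d \<le> card {l\<in>L. x \<in> S l \<and> S l \<subseteq> W}" using W(3) le_trans by blast
    then show ?thesis using W by blast
  qed
qed

definition clear_of :: "'a::real_normed_vector \<Rightarrow> 'a set \<Rightarrow> bool" where
  "clear_of y P \<longleftrightarrow> (\<forall>p\<in>P. y \<noteq> p \<and> norm (y - p) \<noteq> 1)"

definition extendable :: "bool \<Rightarrow> 'v graph \<Rightarrow> nat \<Rightarrow> 'a::real_normed_vector set \<Rightarrow> bool" where
  "extendable ind H M W \<longleftrightarrow> (\<forall>w\<in>W. \<forall>P\<subseteq>W. finite P \<longrightarrow> card P \<le> M \<longrightarrow>
     (\<exists>g. unit_embedding ind H g \<and> w \<in> g ` verts H \<and> g ` verts H \<subseteq> W \<and>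
          (\<forall>y\<in>g ` verts H - {w}. clear_of y (P - {w}))))"

definition rich :: "bool \<Rightarrow> 'v graph \<Rightarrow> nat \<Rightarrow> 'a::real_normed_vector set \<Rightarrow> bool" where
  "rich ind H M W \<longleftrightarrow> extendable ind H M W \<and>
     (\<forall>P\<subseteq>W. finite P \<longrightarrow> card P \<le> M \<longrightarrow> (\<exists>w\<in>W. clear_of w P))"

lemma extendableE:
  assumes "extendable ind H M W" "w \<in> W" "P \<subseteq> W" "finite P" "card P \<le> M"
  obtains g where "unit_embedding ind H g" "w \<in> g ` verts H" "g ` verts H \<subseteq> W"
    "\<forall>y\<in>g ` verts H - {w}. clear_of y (P - {w})"
  using assms unfolding extendable_def by meson

text \<open>Two steps along copies of \<open>H\<close> lead away from any given \<open>P\<close>.\<close>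

lemma rich_if_extendable:
  assumes "W \<noteq> {}" and two_verts: "2 \<le> card (verts H)" and extendable: "extendable ind H (Suc M) W"
  shows "rich ind H M W"
proof -
  have step: "\<exists>y\<in>W. y \<noteq> w \<and> clear_of y (P - {w})"
    if w: "w \<in> W" and P: "P \<subseteq> W" "finite P" "card P \<le> Suc M" for w P
  proof -
    obtain g where g: "unit_embedding ind H g" "g ` verts H \<subseteq> W"
      "\<forall>y\<in>g ` verts H - {w}. clear_of y (P - {w})"
      by (rule extendableE[OF extendable w P])
    have "card (g ` verts H) = card (verts H)"
      by (rule card_image[OF unit_embedding_inj_on[OF g(1)]])
    then have "\<not> g ` verts H \<subseteq> {w}" using two_verts card_mono[of "{w}" "g ` verts H"] by auto
    then show ?thesis using g by blast
  qed
  have "\<exists>w\<in>W. clear_of w P" if P: "P \<subseteq> W" "finite P" "card P \<le> M" for P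
  proof -
    obtain w where w: "w \<in> W" using assms by blast
    obtain y where y: "y \<in> W" "y \<noteq> w" "clear_of y (P - {w})" using step[OF w P(1,2)] P by auto
    then have "y \<notin> P" by (auto simp: clear_of_def)
    have "card (insert w P) \<le> Suc M" using P by (simp add: card_insert_if)
    then obtain x where x: "x \<in> W" "clear_of x (insert w P - {y})"
      using step[OF y(1), of "insert w P"] P w by auto
    then have "clear_of x P" using \<open>y \<notin> P\<close> by (auto simp: clear_of_def)
    then show ?thesis using x(1) by blast
  qed
  moreover have "extendable ind H M W" using extendable unfolding extendable_def by (meson le_SucI)
  ultimately show ?thesis by (simp add: rich_def)
qed

lemma exists_rich_singleton:
  fixes c :: "'a::euclidean_space \<Rightarrow> nat"
  assumes colouring: "c \<in> UNIV \<rightarrow> {..<r}" and singleton: "simple_graph H" "card (verts H) = 1"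
  shows "\<exists>i W. (\<forall>x\<in>W. c x = i) \<and> rich ind H M W"
proof -
  obtain h where verts_H: "verts H = {h}" using singleton(2) by (auto simp: card_1_singleton_iff)
  have no_loop: "{h} \<notin> edges H"
    using singleton(1) unfolding simple_graph_def by (auto simp: singleton_insert_inj_eq)
  have "infinite (ball (0::'a) (1/2))"
    using uncountable_ball[of "1/2" "0::'a"] countable_finite by auto
  moreover have "finite (c ` ball 0 (1/2))"
    by (rule finite_subset[of _ "{..<r}"]) (use colouring in auto)
  ultimately obtain i where infinite_class: "infinite {x \<in> ball (0::'a) (1/2). c x = i}"
    using pigeonhole_infinite[of "ball (0::'a) (1/2)" c] by metis
  define W where "W = {x \<in> ball (0::'a) (1/2). c x = i}"
  have "extendable ind H M W"
    unfolding extendable_def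
  proof (intro ballI allI impI)
    fix w and P :: "'a set" assume "w \<in> W"
    have "unit_embedding ind H (\<lambda>_. w)" using no_loop by (auto simp: unit_embedding_def verts_H)
    then show "\<exists>g. unit_embedding ind H g \<and> w \<in> g ` verts H \<and> g ` verts H \<subseteq> W \<and>
             (\<forall>y\<in>g ` verts H - {w}. clear_of y (P - {w}))"
      using \<open>w \<in> W\<close> by (intro exI[of _ "\<lambda>_. w"]) (auto simp: verts_H)
  qed
  moreover have "\<exists>w\<in>W. clear_of w P" if P: "P \<subseteq> W" "finite P" for P
  proof -
    obtain w where w: "w \<in> W - P"
      using infinite_class P(2) unfolding W_def
      by (metis (no_types, lifting) Diff_infinite_finite finite.emptyI ex_in_conv)
    have "norm (w - p) \<noteq> 1" if "p \<in> P" for p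
    proof -
      have "norm w < 1/2" "norm p < 1/2" using w that P by (auto simp: W_def)
      then show ?thesis using norm_triangle_ineq4[of w p] by linarith
    qed
    then have "clear_of w P" using w by (auto simp: clear_of_def)
    then show ?thesis using w by blast
  qed
  moreover have "\<forall>x\<in>W. c x = i" by (simp add: W_def)
  ultimately show ?thesis unfolding rich_def by blast
qed

definition grid_lines :: "nat \<Rightarrow> 'a set \<Rightarrow> (nat \<times> (nat \<Rightarrow> 'a)) set" where
  "grid_lines N X = (SIGMA j:{..<N}. ({..<N} - {j}) \<rightarrow>\<^sub>E X)"

lemma grid_lineD:
  assumes "(j, z) \<in> grid_lines N X"
  shows "j < N" "z j = undefined" "p \<in> X \<Longrightarrow> z(j := p) \<in> grid N X"
  using assms by (auto simp: grid_lines_def grid_def PiE_iff extensional_def)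

lemma card_grid_lines:
  assumes "finite X"
  shows "finite (grid_lines N X)" "card (grid_lines N X) = N * card X ^ (N - 1)"
proof -
  have fin: "finite (({..<N} - {j}) \<rightarrow>\<^sub>E X)" for j using assms by (intro finite_PiE) auto
  show "finite (grid_lines N X)" unfolding grid_lines_def by (intro finite_SigmaI fin) auto
  have "card (grid_lines N X) = (\<Sum>j<N. card (({..<N} - {j}) \<rightarrow>\<^sub>E X))"
    unfolding grid_lines_def using fin by (intro card_SigmaI) auto
  also have "\<dots> = (\<Sum>j<N. card X ^ (N - 1))" by (intro sum.cong) (auto simp: card_PiE)
  finally show "card (grid_lines N X) = N * card X ^ (N - 1)" by simp
qed

definition copy_directions ::
  "bool \<Rightarrow> 'v graph \<Rightarrow> 'a::real_normed_vector set \<Rightarrow> ((nat \<Rightarrow> 'a) \<Rightarrow> nat) \<Rightarrow> nat \<Rightarrow> nat \<Rightarrow>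
    (nat \<Rightarrow> 'a) set \<Rightarrow> (nat \<Rightarrow> 'a) \<Rightarrow> nat set" where
  "copy_directions ind H X \<kappa> i N W w = {j. j < N \<and> (\<exists>g. mono_line_copy ind H X \<kappa> i j w g \<and>
     w j \<in> g ` verts H \<and> (\<forall>v\<in>verts H. w(j := g v) \<in> W))}"

lemma finite_copy_directions [simp]: "finite (copy_directions ind H X \<kappa> i N W w)"
  by (simp add: copy_directions_def)

lemma copy_directions_colour:
  assumes "copy_directions ind H X \<kappa> i N W w \<noteq> {}"
  shows "\<kappa> w = i"
proof -
  obtain j g v where "mono_line_copy ind H X \<kappa> i j w g" "v \<in> verts H" and v: "w j = g v"
    using assms by (auto simp: copy_directions_def)
  then have "\<kappa> (w(j := g v)) = i" by (simp add: mono_line_copy_def)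
  then show ?thesis by (simp flip: v)
qed

lemma exists_popular_line_colour:
  fixes X :: "'a::real_normed_vector set"
  assumes "finite X" "X \<noteq> {}" and many: "r * d * card X < N"
    and colour: "\<And>l. l \<in> grid_lines N X \<Longrightarrow> colour l < r"
  shows "\<exists>i. d * card (grid N X) < card {l \<in> grid_lines N X. colour l = i}"
proof -
  have "N = Suc (N - 1)" using many by simp
  then have grid: "card (grid N X) = card X * card X ^ (N - 1)"
    using assms(1) by (metis card_grid power_Suc)
  obtain p where "p \<in> X" using assms(2) by blast
  then have "(0, \<lambda>j\<in>{..<N} - {0}. p) \<in> grid_lines N X" using many by (auto simp: grid_lines_def)
  then have "0 < r" using colour by fastforce
  then obtain i where "card (grid_lines N X) \<le> r * card (grid_lines N X \<inter> {l. colour l = i})"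
    using exists_popular_class[of "grid_lines N X" r "\<lambda>i. {l. colour l = i}"] colour
      card_grid_lines(1)[OF assms(1)] by auto
  then have popular: "N * card X ^ (N - 1) \<le> r * card {l \<in> grid_lines N X. colour l = i}"
    by (simp add: card_grid_lines(2)[OF assms(1)] Int_def)
  have "r * d * card X * card X ^ (N - 1) < N * card X ^ (N - 1)"
    using many assms(1,2) by (simp add: card_gt_0_iff)
  also note popular
  finally have "r * (d * card (grid N X)) < r * card {l \<in> grid_lines N X. colour l = i}"
    by (simp add: grid ac_simps)
  then show ?thesis by auto
qed

definition line_image :: "'v graph \<Rightarrow> ('v \<Rightarrow> 'a) \<Rightarrow> nat \<times> (nat \<Rightarrow> 'a) \<Rightarrow> (nat \<Rightarrow> 'a) set" where
  "line_image H g = (\<lambda>(j, z). (\<lambda>v. z(j := g v)) ` verts H)"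

lemma card_lines_through_le:
  assumes lines: "L \<subseteq> grid_lines N X"
    and copy: "\<And>j z. (j, z) \<in> L \<Longrightarrow> mono_line_copy ind H X \<kappa> i j z (g (j, z))"
  shows "card {l \<in> L. w \<in> line_image H (g l) l \<and> line_image H (g l) l \<subseteq> W} \<le>
    card (copy_directions ind H X \<kappa> i N W w)" (is "card ?T \<le> _")
proof -
  have line: "snd l = w(fst l := undefined)" if "l \<in> ?T" for l
    using that grid_lineD(2)[OF subsetD[OF lines], of "fst l" "snd l"]
    by (auto simp: line_image_def split_beta)
  have "j \<in> copy_directions ind H X \<kappa> i N W w" if mem: "(j, z) \<in> ?T" for j z
  proof -
    have w: "w = z(j := w j)" using line[OF mem] by simp
    have "mono_line_copy ind H X \<kappa> i j w (g (j, z))" using copy[of j z] mem by (subst w) simp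
    moreover have "w j \<in> g (j, z) ` verts H" using mem by (auto simp: line_image_def)
    moreover have "w(j := g (j, z) v) \<in> W" if "v \<in> verts H" for v
      using mem that by (subst w) (auto simp: line_image_def)
    moreover have "j < N" using mem grid_lineD(1)[OF subsetD[OF lines]] by auto
    ultimately show ?thesis by (auto simp: copy_directions_def)
  qed
  moreover have "inj_on fst ?T"
    using line by (intro inj_onI) (metis (no_types, lifting) prod_eqI)
  ultimately show ?thesis by (intro card_inj_on_le) auto
qed

lemma exists_subset_with_many_copy_directions:
  fixes X :: "'a::real_normed_vector set"
  assumes "finite X" "X \<noteq> {}" and arrows: "arrows ind X H r" and "verts H \<noteq> {}"
    and colouring: "\<kappa> \<in> UNIV \<rightarrow> {..<r}" and many: "r * d * card X < N"
  shows "\<exists>i W. W \<subseteq> grid N X \<and> W \<noteq> {} \<and> (\<forall>w\<in>W. d \<le> card (copy_directions ind H X \<kappa> i N W w))"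
proof -
  have "\<exists>g i. i < r \<and> mono_line_copy ind H X \<kappa> i (fst l) (snd l) g" for l
    by (rule exists_mono_line_copy[OF arrows assms(4) colouring])
  then obtain g colour where colour: "\<And>l. colour l < r"
    and copy: "\<And>l. mono_line_copy ind H X \<kappa> (colour l) (fst l) (snd l) (g l)"
    by metis
  obtain i where popular: "d * card (grid N X) < card {l \<in> grid_lines N X. colour l = i}"
    using exists_popular_line_colour[OF assms(1,2) many] colour by blast
  define L where "L = {l \<in> grid_lines N X. colour l = i}"
  have "line_image H (g l) l \<subseteq> grid N X \<and> line_image H (g l) l \<noteq> {}" if "l \<in> L" for l
    using that copy[of l] assms(4) grid_lineD(3)[of "fst l" "snd l"]
    by (auto simp: line_image_def L_def mono_line_copy_def split_beta)
  moreover have "finite L" using card_grid_lines(1)[OF assms(1)] by (simp add: L_def)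
  ultimately obtain W where W: "W \<subseteq> grid N X" "W \<noteq> {}"
    and degree: "\<forall>w\<in>W. d \<le> card {l \<in> L. w \<in> line_image H (g l) l \<and> line_image H (g l) l \<subseteq> W}"
    using exists_min_degree_subset[OF finite_grid[OF assms(1)], of L "\<lambda>l. line_image H (g l) l" N d]
      popular unfolding L_def[symmetric] by blast
  have "mono_line_copy ind H X \<kappa> i j z (g (j, z))" if "(j, z) \<in> L" for j z
    using copy[of "(j, z)"] that by (simp add: L_def)
  then have "card {l \<in> L. w \<in> line_image H (g l) l \<and> line_image H (g l) l \<subseteq> W} \<le>
      card (copy_directions ind H X \<kappa> i N W w)" for w
    by (intro card_lines_through_le) (auto simp: L_def)
  then show ?thesis using W degree by (meson le_trans)
qed

lemma exists_direction_off_near_coords: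
  assumes "finite D" "finite Q" "2 * card Q < card D"
  shows "\<exists>j\<in>D. \<forall>q\<in>Q. card (diff_coords N w q) \<le> 2 \<longrightarrow> j \<notin> diff_coords N w q"
proof -
  define near where "near q = (if card (diff_coords N w q) \<le> 2 then diff_coords N w q else {})"
    for q
  have "card (\<Union>q\<in>Q. near q) \<le> (\<Sum>q\<in>Q. card (near q))" by (rule card_UN_le[OF assms(2)])
  also have "\<dots> \<le> (\<Sum>q\<in>Q. 2)" by (rule sum_mono) (auto simp: near_def)
  finally have "card (\<Union>q\<in>Q. near q) < card D" using assms(3) by simp
  moreover have "finite (\<Union>q\<in>Q. near q)" using assms(2) by (auto simp: near_def)
  ultimately obtain j where "j \<in> D" "j \<notin> (\<Union>q\<in>Q. near q)"
    by (meson card_mono not_le subsetI)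
  then show ?thesis by (intro bexI[of _ j]) (auto simp: near_def)
qed

lemma two_le_card_diff_coords_upd:
  assumes "w \<in> grid N X" "q \<in> grid N X" "w \<noteq> q" "j < N" "p \<noteq> w j"
    and off: "card (diff_coords N w q) \<le> 2 \<longrightarrow> j \<notin> diff_coords N w q"
  shows "2 \<le> card (diff_coords N (w(j := p)) q)"
proof (cases "card (diff_coords N w q) \<le> 2")
  case True
  then have "j \<notin> diff_coords N w q" using off by blast
  moreover from this have "diff_coords N (w(j := p)) q = insert j (diff_coords N w q)"
    using assms(4,5) by (auto simp: diff_coords_def)
  moreover have "0 < card (diff_coords N w q)"
    using assms(3) by (simp add: card_gt_0_iff diff_coords_eq_empty_iff[OF assms(1,2)])
  ultimately show ?thesis by simp
next
  case False
  have "diff_coords N w q - {j} \<subseteq> diff_coords N (w(j := p)) q" by (auto simp: diff_coords_def)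
  then have "card (diff_coords N w q - {j}) \<le> card (diff_coords N (w(j := p)) q)"
    by (intro card_mono) auto
  moreover have "card (diff_coords N w q) - 1 \<le> card (diff_coords N w q - {j})"
    by (simp add: card_Diff_singleton_if)
  ultimately show ?thesis using False by linarith
qed

lemma clear_of_line_point:
  assumes generic: "generic_grid_map N X \<phi>"
    and grid: "w \<in> grid N X" "w(j := p) \<in> grid N X" "Q \<subseteq> grid N X"
    and j: "j < N" "p \<noteq> w j"
    and off: "\<And>q. q \<in> Q \<Longrightarrow> card (diff_coords N w q) \<le> 2 \<longrightarrow> j \<notin> diff_coords N w q"
  shows "clear_of (\<phi> (w(j := p))) (\<phi> ` Q - {\<phi> w})"
  unfolding clear_of_def
proof
  fix x assume "x \<in> \<phi> ` Q - {\<phi> w}"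
  then obtain q where q: "q \<in> Q" "x = \<phi> q" "w \<noteq> q" by auto
  then have q_grid: "q \<in> grid N X" using grid(3) by blast
  have far: "2 \<le> card (diff_coords N (w(j := p)) q)"
    using two_le_card_diff_coords_upd[OF grid(1) q_grid q(3) j] off[OF q(1)] by blast
  then have "norm (\<phi> (w(j := p)) - x) \<noteq> 1"
    unfolding q(2) by (rule generic_grid_map_off_line[OF generic grid(2) q_grid])
  moreover have "w(j := p) \<noteq> q" using far by (auto simp: diff_coords_def)
  then have "\<phi> (w(j := p)) \<noteq> x"
    using inj_onD[OF generic_grid_map_inj_on[OF generic] _ grid(2) q_grid] q(2) by blast
  ultimately show "\<phi> (w(j := p)) \<noteq> x \<and> norm (\<phi> (w(j := p)) - x) \<noteq> 1" by blast
qed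

lemma extendable_image:
  assumes generic: "generic_grid_map N X \<phi>" and W_grid: "W \<subseteq> grid N X"
    and many: "\<And>w. w \<in> W \<Longrightarrow> 2 * M < card (copy_directions ind H X \<kappa> i N W w)"
  shows "extendable ind H M (\<phi> ` W)"
  unfolding extendable_def
proof (intro ballI allI impI)
  fix y P assume "y \<in> \<phi> ` W" and P: "P \<subseteq> \<phi> ` W" "finite P" "card P \<le> M"
  then obtain w where w: "w \<in> W" "y = \<phi> w" by blast
  obtain Q where Q: "Q \<subseteq> W" "P = \<phi> ` Q" using P(1) by (meson subset_image_iff)
  then have "inj_on \<phi> Q"
    using generic_grid_map_inj_on[OF generic] W_grid by (meson inj_on_subset)
  then have "finite Q" "card Q = card P" using P(2) Q(2) by (auto simp: finite_image_iff card_image)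
  then obtain j where j: "j \<in> copy_directions ind H X \<kappa> i N W w"
    and off: "\<And>q. q \<in> Q \<Longrightarrow> card (diff_coords N w q) \<le> 2 \<longrightarrow> j \<notin> diff_coords N w q"
    using exists_direction_off_near_coords[of "copy_directions ind H X \<kappa> i N W w" Q N w]
      many[OF w(1)] P(3) by auto
  obtain g where copy: "mono_line_copy ind H X \<kappa> i j w g" and "w j \<in> g ` verts H" and "j < N"
    and in_W: "\<And>v. v \<in> verts H \<Longrightarrow> w(j := g v) \<in> W"
    using j by (auto simp: copy_directions_def)
  define e where "e v = \<phi> (w(j := g v))" for v
  have "unit_embedding ind H e"
    using unit_embedding_line[OF generic \<open>j < N\<close>, of ind H g] copy
    by (simp add: e_def[abs_def] mono_line_copy_def)
  moreover have "y \<in> e ` verts H"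
  proof -
    obtain v where v: "v \<in> verts H" "w j = g v" using \<open>w j \<in> g ` verts H\<close> by blast
    have "e v = y" by (simp add: e_def w(2) flip: v(2))
    then show ?thesis using v(1) by blast
  qed
  moreover have "e ` verts H \<subseteq> \<phi> ` W" using in_W by (auto simp: e_def)
  moreover have "clear_of (e v) (P - {y})" if "v \<in> verts H" "e v \<noteq> y" for v
    unfolding e_def Q(2) w(2)
    by (rule clear_of_line_point[OF generic _ _ _ \<open>j < N\<close> _ off])
      (use that w in_W[OF that(1)] Q(1) W_grid in \<open>auto simp: e_def\<close>)
  ultimately show "\<exists>g. unit_embedding ind H g \<and> y \<in> g ` verts H \<and> g ` verts H \<subseteq> \<phi> ` W \<and>
      (\<forall>x\<in>g ` verts H - {y}. clear_of x (P - {y}))"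
    by blast
qed

lemma exists_rich_set:
  fixes c :: "'a::euclidean_space \<Rightarrow> nat" and H :: "'v graph"
  assumes dim: "2 \<le> DIM('a)" and simple: "simple_graph H"
    and arrows: "arrows ind (UNIV :: 'a set) H r" and colouring: "c \<in> UNIV \<rightarrow> {..<r}"
  shows "\<exists>i W. (\<forall>x\<in>W. c x = i) \<and> rich ind H M W"
proof (cases "card (verts H) = 1")
  case True
  then show ?thesis using exists_rich_singleton[OF colouring simple] by blast
next
  case False
  have fin: "finite (verts H)" "verts H \<noteq> {}" using simple by (auto simp: simple_graph_def)
  then have "card (verts H) \<noteq> 0" by simp
  then have two: "2 \<le> card (verts H)" using False by linarith
  obtain X :: "'a set" where unavoidable: "finite X" "arrows ind X H r"
    using arrows_finite_subset[OF fin(1) arrows] by blast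
  have "X \<noteq> {}" using unavoidable(2) colouring fin(2) unfolding arrows_def by (auto simp: Pi_iff)
  define d where "d = Suc (2 * Suc M)"
  define N where "N = Suc (r * d * card X)"
  obtain \<phi> where generic: "generic_grid_map N X \<phi>"
    using exists_generic_grid_map[OF dim unavoidable(1)] by blast
  have "c \<circ> \<phi> \<in> UNIV \<rightarrow> {..<r}" using colouring by auto
  moreover have "r * d * card X < N" by (simp add: N_def)
  ultimately obtain i W where W: "W \<subseteq> grid N X" "W \<noteq> {}"
    and dirs: "\<And>w. w \<in> W \<Longrightarrow> d \<le> card (copy_directions ind H X (c \<circ> \<phi>) i N W w)"
    using exists_subset_with_many_copy_directions[OF unavoidable(1) \<open>X \<noteq> {}\<close> unavoidable(2) fin(2)]
    by metis
  have many: "2 * Suc M < card (copy_directions ind H X (c \<circ> \<phi>) i N W w)" if "w \<in> W" for w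
    using dirs[OF that] unfolding d_def by linarith
  then have "extendable ind H (Suc M) (\<phi> ` W)" by (rule extendable_image[OF generic W(1)])
  with W(2) have "rich ind H M (\<phi> ` W)" by (intro rich_if_extendable two) simp
  moreover have "c (\<phi> w) = i" if "w \<in> W" for w
  proof -
    have "0 < card (copy_directions ind H X (c \<circ> \<phi>) i N W w)" using many[OF that] by linarith
    then have "copy_directions ind H X (c \<circ> \<phi>) i N W w \<noteq> {}" by (simp add: card_gt_0_iff)
    from copy_directions_colour[OF this] show ?thesis by simp
  qed
  ultimately show ?thesis by (intro exI[of _ i] exI[of _ "\<phi> ` W"]) simp
qed

section \<open>Forests\<close>

definition graph_union :: "'v graph \<Rightarrow> 'v graph \<Rightarrow> 'v graph" where
  "graph_union G K = (verts G \<union> verts K, edges G \<union> edges K)"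

lemma
  shows verts_graph_union [simp]: "verts (graph_union G K) = verts G \<union> verts K"
    and edges_graph_union [simp]: "edges (graph_union G K) = edges G \<union> edges K"
  by (simp_all add: graph_union_def)

lemma is_forest_of_induct [consumes 1, case_names copy union]:
  fixes F :: "'w graph"
  assumes forest_F: "is_forest_of F H"
    and copy: "\<And>K :: 'w graph. copy_of K H \<Longrightarrow> P K"
    and union: "\<And>G K :: 'w graph. \<lbrakk>is_forest_of G H; P G; copy_of K H;
      card (verts K \<inter> verts G) \<le> 1\<rbrakk> \<Longrightarrow> P (graph_union G K)"
  shows "P F"
proof -
  define forest where "forest Hs = (\<Union>i<length Hs. verts (Hs ! i), \<Union>i<length Hs. edges (Hs ! i))"
    for Hs :: "'w graph list"
  define valid where "valid Hs \<longleftrightarrow> Hs \<noteq> [] \<and> (\<forall>i < length Hs. copy_of (Hs ! i) H) \<and>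
     (\<forall>i < length Hs. \<forall>j < i. edges (Hs ! i) \<inter> edges (Hs ! j) = {}) \<and>
     (\<forall>i < length Hs. card (verts (Hs ! i) \<inter> (\<Union>j<i. verts (Hs ! j))) \<le> 1)" for Hs :: "'w graph list"
  have is_forest: "is_forest_of G H \<longleftrightarrow> (\<exists>Hs. valid Hs \<and> G = forest Hs)" for G :: "'w graph"
    unfolding is_forest_of_def valid_def forest_def by blast
  have "valid Hs \<Longrightarrow> P (forest Hs)" for Hs
  proof (induction Hs rule: rev_induct)
    case Nil
    then show ?case by (simp add: valid_def)
  next
    case (snoc K Hs)
    have K: "copy_of K H" "card (verts K \<inter> verts (forest Hs)) \<le> 1"
      using snoc.prems by (auto simp: valid_def forest_def nth_append All_less_Suc)
    show ?case
    proof (cases "Hs = []")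
      case True
      then have "forest (Hs @ [K]) = K" by (simp add: forest_def lessThan_Suc)
      then show ?thesis using copy[OF K(1)] by simp
    next
      case False
      then have "valid Hs" using snoc.prems by (auto simp: valid_def nth_append All_less_Suc)
      moreover have "forest (Hs @ [K]) = graph_union (forest Hs) K"
        by (auto simp: forest_def graph_union_def lessThan_Suc nth_append)
      ultimately show ?thesis using union[OF _ snoc.IH K] is_forest by auto
    qed
  qed
  moreover obtain Hs where "valid Hs" "F = forest Hs" using forest_F is_forest by blast
  ultimately show ?thesis by simp
qed

lemma simple_graph_copy: "copy_of K H \<Longrightarrow> simple_graph H \<Longrightarrow> simple_graph K"
  unfolding copy_of_def using simple_graph_iso by blast

lemma simple_graph_forest:
  assumes "is_forest_of F H" and simple: "simple_graph H"
  shows "simple_graph F"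
  using assms(1)
proof (induction rule: is_forest_of_induct)
  case (copy K)
  then show ?case by (rule simple_graph_copy[OF _ simple])
next
  case (union G K)
  have "simple_graph K" by (rule simple_graph_copy[OF union.hyps(2) simple])
  with union.IH show ?case by (simp add: simple_graph_def) blast
qed

lemma graph_union_embedding:
  assumes simple_G: "simple_graph G" and simple_K: "simple_graph K"
    and meet: "card (verts K \<inter> verts G) \<le> 1"
  shows "graph_embedding ind id G (graph_union G K)"
proof -
  have "{x, y} \<notin> edges K" if xy: "x \<in> verts G" "y \<in> verts G" for x y
  proof
    assume edge: "{x, y} \<in> edges K"
    then have "x \<noteq> y" using simple_graph_edgeE[OF simple_K edge] by (metis doubleton_eq_iff)
    moreover have "{x, y} \<subseteq> verts K \<inter> verts G"
      using simple_graph_edge_subset[OF simple_K edge] xy by blast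
    then have "card {x, y} \<le> card (verts K \<inter> verts G)"
      using simple_K by (intro card_mono) (auto simp: simple_graph_def)
    ultimately show False using meet by simp
  qed
  then show ?thesis by (auto simp: graph_embedding_def)
qed

lemma forest_contains_induced:
  assumes "is_forest_of F H" and simple: "simple_graph H"
  shows "\<exists>f. graph_embedding ind f H F"
  using assms(1)
proof (induction rule: is_forest_of_induct)
  case (copy K)
  then show ?case using graph_iso_imp_embedding[OF _ simple] unfolding copy_of_def by blast
next
  case (union G K)
  have "graph_embedding ind id G (graph_union G K)"
    using union.hyps
    by (intro graph_union_embedding simple_graph_forest[OF _ simple] simple_graph_copy[OF _ simple])
  then show ?case using union.IH graph_embedding_comp by blast
qed

lemma exists_rooted_unit_embedding:
  assumes graph: "simple_graph H" "vertex_transitive H" and copy: "copy_of K H"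
    and unit: "unit_embedding ind H g" and "w \<in> g ` verts H" and x: "x \<in> verts K"
  shows "\<exists>e. unit_embedding ind K e \<and> e x = w \<and> e ` verts K \<subseteq> g ` verts H"
proof -
  obtain f where iso: "graph_iso f K H"
    using copy graph_iso_inv_into[OF _ graph(1)] unfolding copy_of_def by blast
  obtain v where v: "v \<in> verts H" "w = g v" using assms(5) by blast
  have "f x \<in> verts H" using iso x by (auto simp: graph_iso_def bij_betw_def)
  then obtain \<sigma> where automorphism: "graph_iso \<sigma> H H" "\<sigma> (f x) = v"
    using graph(2) v(1) unfolding vertex_transitive_def by blast
  have emb: "graph_embedding ind (\<sigma> \<circ> f) K H"
    using graph_iso_imp_embedding[OF iso simple_graph_copy[OF copy graph(1)]]
      graph_iso_imp_embedding[OF automorphism(1) graph(1)] by (rule graph_embedding_comp)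
  have "(g \<circ> (\<sigma> \<circ> f)) ` verts K \<subseteq> g ` verts H"
    using image_mono[OF graph_embedding_image[OF emb], of g] by (simp add: image_comp)
  moreover have "(g \<circ> (\<sigma> \<circ> f)) x = w" by (simp add: automorphism(2) v(2))
  ultimately show ?thesis using unit_embedding_comp[OF emb unit] by blast
qed

lemma unit_embedding_graph_union:
  assumes emb_G: "unit_embedding ind G \<theta>" and emb_K: "unit_embedding ind K e"
    and edges: "edges G \<subseteq> Pow (verts G)" "edges K \<subseteq> Pow (verts K)"
    and agree: "\<And>a. a \<in> verts K \<inter> verts G \<Longrightarrow> e a = \<theta> a"
    and new: "\<And>a b. a \<in> verts K - verts G \<Longrightarrow> b \<in> verts G \<Longrightarrow> e a \<noteq> \<theta> b"
    and far: "\<And>a b. a \<in> verts K - verts G \<Longrightarrow> b \<in> verts G - verts K \<Longrightarrow> norm (e a - \<theta> b) \<noteq> 1"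
  shows "unit_embedding ind (graph_union G K) (\<lambda>v. if v \<in> verts G then \<theta> v else e v)"
proof -
  define t where "t v = (if v \<in> verts G then \<theta> v else e v)" for v
  have on_G: "t v = \<theta> v" if "v \<in> verts G" for v using that by (simp add: t_def)
  have on_K: "t v = e v" if "v \<in> verts K" for v using that agree by (simp add: t_def)
  have "inj_on e (verts K - verts G)"
    by (rule inj_on_subset[OF unit_embedding_inj_on[OF emb_K]]) blast
  moreover have "\<theta> ` verts G \<inter> e ` (verts K - verts G) = {}" using new by force
  ultimately have "inj_on t (verts G \<union> (verts K - verts G))"
    unfolding t_def by (rule inj_on_disjoint_Un[OF unit_embedding_inj_on[OF emb_G]])
  then have "inj_on t (verts G \<union> verts K)" by simp
  moreover have "norm (t x - t y) = 1" if "{x, y} \<in> edges G \<union> edges K" for x y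
    using that
  proof
    assume edge: "{x, y} \<in> edges G"
    then have "x \<in> verts G" "y \<in> verts G" using edges(1) by blast+
    then show ?thesis using unit_embedding_edge[OF emb_G] edge by (simp add: on_G)
  next
    assume edge: "{x, y} \<in> edges K"
    then have "x \<in> verts K" "y \<in> verts K" using edges(2) by blast+
    then show ?thesis using unit_embedding_edge[OF emb_K] edge by (simp add: on_K)
  qed
  moreover have "norm (t x - t y) \<noteq> 1"
    if ind: ind and xy: "x \<in> verts G \<union> verts K" "y \<in> verts G \<union> verts K"
      and no_edge: "{x, y} \<notin> edges G \<union> edges K" for x y
  proof -
    consider (in_G) "x \<in> verts G" "y \<in> verts G" | (in_K) "x \<in> verts K" "y \<in> verts K"
      | (across) "x \<in> verts K - verts G" "y \<in> verts G - verts K"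
      | (across') "y \<in> verts K - verts G" "x \<in> verts G - verts K"
      using xy by blast
    then show ?thesis
    proof cases
      case in_G
      then show ?thesis using unit_embedding_induced[OF emb_G ind] no_edge by (auto simp: on_G)
    next
      case in_K
      then show ?thesis using unit_embedding_induced[OF emb_K ind] no_edge by (auto simp: on_K)
    qed (use far in \<open>simp_all add: on_G on_K norm_minus_commute[of "\<theta> x"]\<close>)
  qed
  ultimately show ?thesis unfolding t_def[symmetric] by (simp add: unit_embedding_def)
qed

lemma extendable_rooted_copy:
  assumes simple: "simple_graph H" and transitive: "vertex_transitive H" and copy: "copy_of K H"
    and extendable: "extendable ind H M W" and x: "x \<in> verts K" and w: "w \<in> W"
    and P: "P \<subseteq> W" "finite P" "card P \<le> M"
  shows "\<exists>e. unit_embedding ind K e \<and> e x = w \<and> e ` verts K \<subseteq> W \<and>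
    (\<forall>a\<in>verts K - {x}. e a \<noteq> w \<and> clear_of (e a) (P - {w}))"
proof -
  obtain g where g: "unit_embedding ind H g" "w \<in> g ` verts H" "g ` verts H \<subseteq> W"
    and clear: "\<forall>y\<in>g ` verts H - {w}. clear_of y (P - {w})"
    by (rule extendableE[OF extendable w P])
  obtain e where e: "unit_embedding ind K e" "e x = w" "e ` verts K \<subseteq> g ` verts H"
    using exists_rooted_unit_embedding[OF simple transitive copy g(1,2) x] by blast
  have "e a \<noteq> w" if "a \<in> verts K - {x}" for a
    using inj_onD[OF unit_embedding_inj_on[OF e(1)], of a x] that x e(2) by auto
  then show ?thesis using e g(3) clear by (intro exI[of _ e]) blast
qed

lemma rich_extend_copy:
  fixes \<theta> :: "'w \<Rightarrow> 'a::real_normed_vector"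
  assumes simple: "simple_graph H" and transitive: "vertex_transitive H" and copy: "copy_of K H"
    and rich: "rich ind H M W" and U: "finite U" "card U \<le> M" and meet: "card (verts K \<inter> U) \<le> 1"
    and \<theta>: "inj_on \<theta> U" "\<theta> ` U \<subseteq> W"
  shows "\<exists>e. unit_embedding ind K e \<and> e ` verts K \<subseteq> W \<and> (\<forall>a\<in>verts K \<inter> U. e a = \<theta> a) \<and>
    (\<forall>a\<in>verts K - U. \<forall>b\<in>U. e a \<noteq> \<theta> b \<and> (b \<notin> verts K \<longrightarrow> norm (e a - \<theta> b) \<noteq> 1))"
proof -
  have P: "\<theta> ` U \<subseteq> W" "finite (\<theta> ` U)" "card (\<theta> ` U) \<le> M" using \<theta> U by (auto simp: card_image)
  have "extendable ind H M W" using rich by (simp add: rich_def)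
  note rooted = extendable_rooted_copy[OF simple transitive copy this _ _ P]
  have simple_K: "simple_graph K" by (rule simple_graph_copy[OF copy simple])
  show ?thesis
  proof (cases "verts K \<inter> U = {}")
    case True
    obtain x where x: "x \<in> verts K" using simple_K by (auto simp: simple_graph_def)
    obtain w where w: "w \<in> W" "clear_of w (\<theta> ` U)" using rich P unfolding rich_def by blast
    then have "\<theta> ` U - {w} = \<theta> ` U" by (auto simp: clear_of_def)
    then obtain e where e: "unit_embedding ind K e" "e ` verts K \<subseteq> W"
      and clear: "\<forall>a\<in>verts K. clear_of (e a) (\<theta> ` U)"
      using rooted[OF x w(1)] w(2) by (metis DiffI singletonD)
    then show ?thesis using True by (intro exI[of _ e]) (auto simp: clear_of_def)
  next
    case False
    then obtain x where x: "x \<in> verts K" "x \<in> U" by blast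
    have "verts K \<inter> U = {x}" using card_seteq[of "verts K \<inter> U" "{x}"] U(1) meet x by auto
    obtain e where e: "unit_embedding ind K e" "e x = \<theta> x" "e ` verts K \<subseteq> W"
      and clear: "\<forall>a\<in>verts K - {x}. e a \<noteq> \<theta> x \<and> clear_of (e a) (\<theta> ` U - {\<theta> x})"
      using rooted[OF x(1), of "\<theta> x"] \<theta>(2) x(2) by blast
    have "e a \<noteq> \<theta> b \<and> (b \<notin> verts K \<longrightarrow> norm (e a - \<theta> b) \<noteq> 1)"
      if a: "a \<in> verts K - U" and b: "b \<in> U" for a b
    proof (cases "b = x")
      case True
      then show ?thesis using clear a x by blast
    next
      case False
      then have "\<theta> b \<in> \<theta> ` U - {\<theta> x}" using inj_onD[OF \<theta>(1)] b x(2) by blast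
      then show ?thesis using clear a x(2) unfolding clear_of_def by blast
    qed
    then show ?thesis using e \<open>verts K \<inter> U = {x}\<close> by (intro exI[of _ e]) auto
  qed
qed

lemma rich_extend_embedding:
  fixes \<theta> :: "'w \<Rightarrow> 'a::real_normed_vector"
  assumes graph: "simple_graph H" "vertex_transitive H" and copy: "copy_of K H"
    and rich: "rich ind H M W"
    and G: "finite (verts G)" "card (verts G) \<le> M" "edges G \<subseteq> Pow (verts G)"
    and meet: "card (verts K \<inter> verts G) \<le> 1" and emb: "unit_embedding ind G \<theta>" "\<theta> ` verts G \<subseteq> W"
  shows "\<exists>\<theta>'. unit_embedding ind (graph_union G K) \<theta>' \<and> \<theta>' ` verts (graph_union G K) \<subseteq> W"
proof -
  obtain e where ext: "unit_embedding ind K e" "e ` verts K \<subseteq> W" "\<forall>a\<in>verts K \<inter> verts G. e a = \<theta> a"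
    and new: "\<forall>a\<in>verts K - verts G. \<forall>b\<in>verts G. e a \<noteq> \<theta> b \<and> (b \<notin> verts K \<longrightarrow> norm (e a - \<theta> b) \<noteq> 1)"
    using rich_extend_copy[OF graph copy rich G(1,2) meet unit_embedding_inj_on[OF emb(1)] emb(2)]
    by blast
  have "edges K \<subseteq> Pow (verts K)"
    using simple_graph_edge_subset[OF simple_graph_copy[OF copy graph(1)]] by blast
  then have "unit_embedding ind (graph_union G K) (\<lambda>v. if v \<in> verts G then \<theta> v else e v)"
    using ext new G(3) by (intro unit_embedding_graph_union emb(1)) auto
  moreover have "(\<lambda>v. if v \<in> verts G then \<theta> v else e v) ` verts (graph_union G K) \<subseteq> W"
    using emb(2) ext(2) by auto
  ultimately show ?thesis by blast
qed

lemma forest_embedding: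
  fixes W :: "'a::real_normed_vector set"
  assumes forest: "is_forest_of F H" and graph: "simple_graph H" "vertex_transitive H"
    and rich: "rich ind H M W" and "card (verts F) \<le> M"
  shows "\<exists>\<theta>. unit_embedding ind F \<theta> \<and> \<theta> ` verts F \<subseteq> W"
  using forest assms(5)
proof (induction rule: is_forest_of_induct)
  case (copy K)
  have "graph_union ({}, {}) K = K" by (simp add: graph_union_def)
  moreover have "unit_embedding ind ({}, {}) (\<lambda>_. 0 :: 'a)" by (simp add: unit_embedding_def)
  ultimately show ?case using rich_extend_embedding[OF graph copy(1) rich, of "({}, {})"] by force
next
  case (union G K)
  have "simple_graph G" "simple_graph K"
    using union.hyps simple_graph_forest simple_graph_copy graph(1) by blast+
  then have fin: "finite (verts G)" "finite (verts K)" and edges: "edges G \<subseteq> Pow (verts G)"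
    using simple_graph_edge_subset[of G] by (auto simp: simple_graph_def)
  have "card (verts G) \<le> M" using union.prems fin by (auto intro: order_trans[OF card_mono])
  then show ?case
    using rich_extend_embedding[OF graph union.hyps(2) rich fin(1) _ edges union.hyps(3)] union.IH
    by blast
qed

lemma arrows_forest_iff:
  fixes H :: "'v graph" and F :: "'w graph"
  assumes dim: "2 \<le> DIM('a::euclidean_space)" and graph: "simple_graph H" "vertex_transitive H"
    and forest: "is_forest_of F H"
  shows "arrows ind (UNIV :: 'a set) F r \<longleftrightarrow> arrows ind (UNIV :: 'a set) H r"
proof
  assume "arrows ind (UNIV :: 'a set) F r"
  then show "arrows ind (UNIV :: 'a set) H r"
    using forest_contains_induced[OF forest graph(1)] arrows_if_embedding by blast
next
  assume arrows: "arrows ind (UNIV :: 'a set) H r"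
  show "arrows ind (UNIV :: 'a set) F r"
    unfolding arrows_def
  proof
    fix c :: "'a \<Rightarrow> nat" assume "c \<in> UNIV \<rightarrow> {..<r}"
    then obtain i W where rich_W: "\<forall>x\<in>W. c x = i" "rich ind H (card (verts F)) W"
      using exists_rich_set[OF dim graph(1) arrows] by blast
    obtain \<theta> where "unit_embedding ind F \<theta>" "\<theta> ` verts F \<subseteq> W"
      using forest_embedding[OF forest graph rich_W(2)] by blast
    then show "\<exists>g. unit_embedding ind F g \<and> g ` verts F \<subseteq> UNIV \<and> monochromatic c (g ` verts F)"
      using rich_W(1) unfolding monochromatic_def by blast
  qed
qed

theorem theorem1p5:
  fixes H :: "'v graph"
  assumes "simple_graph H" and "CARD('n::finite) \<ge> 2"
  shows
    "(\<forall>F :: 'w graph. vertex_transitive H \<longrightarrow> is_forest_of F H \<longrightarrow>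
        chi_copy F (UNIV :: (real^'n) set) = chi_copy H (UNIV :: (real^'n) set) \<and>
        chi_ind_copy F (UNIV :: (real^'n) set) = chi_ind_copy H (UNIV :: (real^'n) set)) \<and>
     (edges H \<noteq> {} \<longrightarrow>
        (zero_cube_density H \<longrightarrow>
           chi_copy H (UNIV :: (real^'n) set) = chi (UNIV :: (real^'n) set)) \<and>
        (zero_induced_cube_density H \<longrightarrow>
           chi_ind_copy H (UNIV :: (real^'n) set) = chi (UNIV :: (real^'n) set))) \<and>
     (\<forall>u v (\<Gamma> :: 'g graph) A B.
        u \<in> verts H \<longrightarrow> v \<in> verts H \<longrightarrow> u \<noteq> v \<longrightarrow>
        simple_graph \<Gamma> \<longrightarrow> edges \<Gamma> \<noteq> {} \<longrightarrow> bipartite_with_parts \<Gamma> A B \<longrightarrow>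
        zero_strong_cube_density \<Gamma> A B \<longrightarrow>
        chi_copy (edge_replacement \<Gamma> A B H u v) (UNIV :: (real^'n) set) =
          chi_copy H (UNIV :: (real^'n) set))"
proof -
  let ?space = "UNIV :: (real^'n) set"
  note simple = assms(1)
  have dim: "2 \<le> DIM(real^'n)" using assms(2) by simp
  have "arrows ind ?space F r \<longleftrightarrow> arrows ind ?space H r"
    if "vertex_transitive H" "is_forest_of F H" for ind r and F :: "'w graph"
    by (rule arrows_forest_iff[OF dim simple that])
  moreover have "arrows False ?space H r \<longleftrightarrow> arrows False ?space single_edge r"
    if "edges H \<noteq> {}" "zero_cube_density H" for r
    using arrows_zero_density_iff[OF dim simple that(1) that(2)[unfolded zero_cube_density_iff]]
      contains_copy_imp_embedding[OF _ simple] by blast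
  moreover have "arrows True ?space H r \<longleftrightarrow> arrows False ?space single_edge r"
    if "edges H \<noteq> {}" "zero_induced_cube_density H" for r
    using arrows_zero_density_iff[OF dim simple that(1)
      that(2)[unfolded zero_induced_cube_density_iff]]
      contains_induced_copy_imp_embedding[OF _ simple] by blast
  moreover have "arrows False ?space (edge_replacement \<Gamma> A B H u v) r \<longleftrightarrow> arrows False ?space H r"
    if "u \<in> verts H" "v \<in> verts H" "u \<noteq> v" "edges \<Gamma> \<noteq> {}" "bipartite_with_parts \<Gamma> A B"
      "zero_strong_cube_density \<Gamma> A B" for u v A B r and \<Gamma> :: "'g graph"
    by (rule arrows_edge_replacement_iff[OF dim simple that])
  ultimately show ?thesis unfolding chi_copy_eq chi_ind_copy_eq chi_eq by simp
qed

end
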